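(* Let $G$ be a connected finite simple graph with at least one edge and let $A$ be its (vertex-edge) incidence matrix. Then the system $x\geq 0;\ xA\leq\mathbf{1}$ has the integer rounding property if and only if, for any two vertex-disjoint odd cycles of $G$, the subgraph of $G$ induced by the union of their vertex sets is connected.
   Context: The incidence matrix of $G$ has as columns the vectors $e_i+e_j$, one for each edge $\{x_i,x_j\}$ of $G$. $\mathbf{1}$ is the all-ones vector; vector inequalities are componentwise; $\langle\,,\rangle$ is the standard inner product. For a matrix $A$ with $q$ columns and entries in $\mathbb{N}$, the system $x\geq 0;\ xA\leq\mathbf{1}$ has the integer rounding property if $$\lceil\min\{\langle y,\mathbf{1}\rangle\mid y\in\mathbb{R}^q,\ y\geq 0;\ Ay\geq a\}\rceil=\min\{\langle y,\mathbf{1}\rangle\mid Ay\geq a;\ y\in\mathbb{N}^q\}$$ for each integral vector $a$ for which $\min\{\langle y,\mathbf{1}\rangle\mid y\geq 0;\ Ay\geq a\}$ is finite. *)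

theory Defs
  imports
    "HOL-Analysis.Analysis"
    "Graph_Theory.Digraph_Component"
begin

text \<open>
  The locale \<^locale>\<open>graph\<close> represents a finite simple graph by its symmetric digraph, each edge
  \<open>{u, v}\<close> being the pair of arcs \<open>(u, v)\<close>, \<open>(v, u)\<close>.
  Both theories imported above have a constant called \<open>connected\<close>; the abbreviation
  selects the graph-theoretic one.
\<close>

abbreviation graph_connected :: "('a,'b) pre_digraph \<Rightarrow> bool" where
  "graph_connected \<equiv> Digraph_Component.connected"

definition edges :: "('a,'b) pre_digraph \<Rightarrow> 'a set set" where
  "edges G = {{tail G a, head G a} | a. a \<in> arcs G}"

text \<open>
  Going back and forth along an edge is a \<^const>\<open>pre_digraph.cycle\<close> of length two, but as a graph
  has no loops, an odd cycle has length at least three and is a cycle in the undirected sense.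
\<close>

definition odd_cycle :: "('a,'b) pre_digraph \<Rightarrow> 'b list \<Rightarrow> bool" where
  "odd_cycle G p \<longleftrightarrow> pre_digraph.cycle G p \<and> odd (length p)"

definition cycle_verts :: "('a,'b) pre_digraph \<Rightarrow> 'b list \<Rightarrow> 'a set" where
  "cycle_verts G p = tail G ` set p"

text \<open>
  The functions \<open>x\<close> and \<open>e\<close> enumerate the vertices and the edges.
\<close>

definition incidence_matrix :: "('n::finite \<Rightarrow> 'a) \<Rightarrow> ('q::finite \<Rightarrow> 'a set) \<Rightarrow> nat^'q^'n" where
  "incidence_matrix x e = (\<chi> i j. if x i \<in> e j then 1 else 0)"

lemma column_incidence_matrix:
  assumes "inj x" "e k = {x i, x j}" "i \<noteq> j"
  shows "column k (incidence_matrix x e) = axis i 1 + axis j 1"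
  using assms
  by (auto simp: vec_eq_iff column_def incidence_matrix_def axis_def inj_eq)

definition is_min :: "real set \<Rightarrow> real \<Rightarrow> bool" where
  "is_min S m \<longleftrightarrow> m \<in> S \<and> (\<forall>s\<in>S. m \<le> s)"

definition feasible :: "nat^'q^'n \<Rightarrow> int^'n \<Rightarrow> (real^'q) set" where
  "feasible A a = {y. 0 \<le> y \<and> (\<chi> i. real_of_int (a $ i)) \<le> map_matrix real A *v y}"

text \<open>
  The linear programme is bounded below by zero, so its minimum is finite exactly when it exists.
  The last occurrence of \<^const>\<open>is_min\<close> says that the integer minimum exists and
  equals the rounded-up real minimum.
\<close>

definition integer_rounding :: "nat^'q^'n \<Rightarrow> bool" where
  "integer_rounding A \<longleftrightarrow> (\<forall>a m.
     is_min {y \<bullet> 1 | y. y \<in> feasible A a} m \<longrightarrow>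
     is_min {y \<bullet> 1 | y. y \<in> feasible A a \<and> (\<forall>j. y $ j \<in> \<nat>)} (of_int \<lceil>m\<rceil>))"

lemma (in pre_digraph) cycle_verts_awalk:
  assumes "awalk u p u" "p \<noteq> []"
  shows "cycle_verts G p = set (awalk_verts u p)"
proof -
  have "cas u q v \<Longrightarrow> set (awalk_verts u q) = insert v (tail G ` set q)" for u v q
    by (induction q arbitrary: u) auto
  moreover have "cas u p u \<Longrightarrow> u \<in> tail G ` set p"
    using assms(2) by (cases p) auto
  ultimately show ?thesis
    using assms(1) by (auto simp: awalk_def cycle_verts_def)
qed

end

theory Submission
  imports Defs
begin

text \<open>
  Let \<open>m\<close> be the real minimum. Among the real covers of total at most \<open>\<lceil>m\<rceil>\<close> take one with
  the fewest fractional edges plus slack vertices. Moving it along a kernel vector of the tight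
  constraints that is supported on fractional edges would improve it, so there is no such vector,
  and a count shows that the fractional edges form vertex-disjoint odd cycles, on which all values
  are half-integral. Adding \<open>1/2\<close> and \<open>-1/2\<close> alternately along an odd cycle changes the load only at one
  freely chosen vertex, by \<open>1\<close>. Hence two such cycles can be rounded together by raising an edge
  that joins them, and a remaining single one is rounded up.

  Conversely, if no edge joins two disjoint odd cycles, then the constant \<open>1/2\<close> on their edges is
  an optimal real cover of their vertices with integral value. An integral cover of the same value
  would match each cycle perfectly within itself, contradicting parity.
\<close>

section \<open>Edge vectors and their loads\<close>

text \<open>Coordinate \<open>i\<close> of \<open>A y\<close> when \<open>f j\<close> is the set of
  rows met by edge \<open>j\<close>. Index sets keep the vertices and arcs of \<open>G\<close> out
  of the rounding argument.\<close>

definition load :: "('q::finite \<Rightarrow> 'n set) \<Rightarrow> real^'q \<Rightarrow> 'n \<Rightarrow> real" where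
  "load f y i = (\<Sum>j | i \<in> f j. y $ j)"

lemma load_add: "load f (y + z) i = load f y i + load f z i"
  by (simp add: load_def sum.distrib)

lemma load_diff: "load f (y - z) i = load f y i - load f z i"
  by (simp add: load_def sum_subtractf)

lemma load_scaleR: "load f (c *\<^sub>R y) i = c * load f y i"
  by (simp add: load_def sum_distrib_left)

lemma load_minus: "load f (- y) i = - load f y i"
  by (simp add: load_def sum_negf)

lemma load_sum: "load f (\<Sum>k\<in>K. y k) i = (\<Sum>k\<in>K. load f (y k) i)"
  unfolding load_def by (simp add: sum.swap[of _ K])

lemma load_axis: "load f (axis j c) i = (if i \<in> f j then c else 0)"
  by (simp add: load_def axis_def if_distrib cong: if_cong)

lemmas load_simps = load_add load_diff load_scaleR load_minus load_sum load_axis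

text \<open>Incidences counted by vertices and by edges. \<open>C = UNIV\<close> gives the handshake
  identity, other sets \<open>C\<close> the parity count.\<close>

lemma sum_load:
  fixes f :: "'q::finite \<Rightarrow> 'n::finite set"
  shows "(\<Sum>i\<in>C. load f y i) = (\<Sum>j\<in>UNIV. real (card (f j \<inter> C)) * y $ j)"
proof -
  have "(\<Sum>i\<in>C. load f y i) = (\<Sum>i\<in>C. \<Sum>j\<in>UNIV. if i \<in> f j then y $ j else 0)"
    unfolding load_def by (simp add: sum.If_cases)
  also have "\<dots> = (\<Sum>j\<in>UNIV. \<Sum>i\<in>C. if i \<in> f j then y $ j else 0)"
    by (rule sum.swap)
  also have "\<dots> = (\<Sum>j\<in>UNIV. real (card (f j \<inter> C)) * y $ j)"
  proof (intro sum.cong refl)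
    fix j
    have "(\<Sum>i\<in>C. if i \<in> f j then y $ j else 0) = (\<Sum>i\<in>{i\<in>C. i \<in> f j}. y $ j)"
      by (simp add: sum.inter_filter[symmetric])
    also have "{i\<in>C. i \<in> f j} = f j \<inter> C" by auto
    finally show "(\<Sum>i\<in>C. if i \<in> f j then y $ j else 0) = real (card (f j \<inter> C)) * y $ j"
      by simp
  qed
  finally show ?thesis .
qed

text \<open>Restrict \<open>L\<close> to vectors supported on \<open>F\<close> and project onto the
  coordinates in \<open>T\<close>: injectivity would embed dimension \<open>card F\<close> into
  dimension \<open>card T\<close>.\<close>

lemma nontrivial_kernel:
  fixes L :: "real^'q \<Rightarrow> real^'n"
  assumes "linear L" "card T < card F"
  obtains z where "z \<noteq> 0" "\<And>j. j \<notin> F \<Longrightarrow> z $ j = 0" "\<And>i. i \<in> T \<Longrightarrow> L z $ i = 0"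
proof -
  define S where "S = {z :: real^'q. \<forall>j. j \<notin> F \<longrightarrow> z $ j = 0}"
  define R where "R = {w :: real^'n. \<forall>i. i \<notin> T \<longrightarrow> w $ i = 0}"
  define g where "g z = (\<chi> i. if i \<in> T then L z $ i else 0)" for z
  have g: "linear g"
    using assms(1) unfolding g_def
    by (auto simp: linear_iff vec_eq_iff)
  have S: "subspace S"
    by (auto simp: subspace_def S_def)
  have "\<not> inj_on g S"
  proof
    assume "inj_on g S"
    hence "dim (g ` S) = dim S"
      using dim_image_eq[OF g, of S] S by (metis span_eq_iff)
    moreover have "g ` S \<subseteq> R"
      by (auto simp: g_def R_def)
    hence "dim (g ` S) \<le> dim R" by (rule dim_subset)
    moreover have "dim S = card F" "dim R = card T"
      unfolding S_def R_def using dim_substandard_cart[where 'a=real and d=F] dim_substandard_cart[where 'a=real and d=T] by (simp_all only: dim_vec_eq)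
    ultimately show False using assms(2) by simp
  qed
  then obtain z where "z \<in> S" "z \<noteq> 0" "g z = 0"
    using linear_injective_on_subspace_0[OF g S] by blast
  thus ?thesis
    by (intro that[of z]) (auto simp: S_def g_def vec_eq_iff split: if_splits)
qed

text \<open>A pair \<open>(c, d)\<close> stands for the affine function \<open>c + t * d\<close>,
  positive at time zero. The smallest root among the decreasing ones is the first time that any of
  them vanishes.\<close>

lemma first_hitting_time:
  fixes P :: "(real \<times> real) set"
  assumes "finite P" "\<And>c d. (c, d) \<in> P \<Longrightarrow> 0 < c" "(c0, d0) \<in> P" "d0 < 0"
  obtains t where "\<And>c d. (c, d) \<in> P \<Longrightarrow> 0 \<le> c + t * d" "\<exists>(c, d)\<in>P. c + t * d = 0" "0 < t"
proof -
  define Q where "Q = {p\<in>P. snd p < 0}"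
  define t where "t = Min ((\<lambda>p. fst p / - snd p) ` Q)"
  have Q: "finite Q" "Q \<noteq> {}"
    using assms by (auto simp: Q_def)
  have "t \<in> (\<lambda>p. fst p / - snd p) ` Q"
    unfolding t_def using Q by (intro Min_in) auto
  then obtain c d where cd: "(c, d) \<in> P" "d < 0" "t = c / - d"
    by (auto simp: Q_def)
  have le: "t \<le> c' / - d'" if "(c', d') \<in> P" "d' < 0" for c' d'
  proof -
    have "c' / - d' \<in> (\<lambda>p. fst p / - snd p) ` Q"
      using that by (intro rev_image_eqI[of "(c', d')"]) (auto simp: Q_def)
    thus ?thesis unfolding t_def using Q by (intro Min_le) auto
  qed
  have t: "0 < t" using cd(2,3) assms(2)[OF cd(1)] by (simp only: divide_pos_pos neg_0_less_iff_less)
  show ?thesis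
  proof (rule that)
    fix c' d' assume *: "(c', d') \<in> P"
    show "0 \<le> c' + t * d'"
    proof (cases "d' < 0")
      case True
      thus ?thesis using le[OF * True] by (simp add: field_simps)
    next
      case False
      hence "0 \<le> t * d'" using t by simp
      thus ?thesis using assms(2)[OF *] by linarith
    qed
  next
    have "c + t * d = 0" using cd by (simp add: field_simps)
    with cd show "\<exists>(c, d)\<in>P. c + t * d = 0" by blast
  qed (fact t)
qed

section \<open>Fractional edges, slack vertices and perturbations that reduce them\<close>

definition fractional :: "real^'q \<Rightarrow> 'q set" where
  "fractional y = {j. y $ j \<notin> \<int>}"

definition slack :: "('q::finite \<Rightarrow> 'n set) \<Rightarrow> ('n \<Rightarrow> int) \<Rightarrow> real^'q \<Rightarrow> 'n set" where
  "slack f a y = {i. load f y i \<noteq> of_int (a i)}"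

definition covers :: "('q::finite \<Rightarrow> 'n set) \<Rightarrow> ('n \<Rightarrow> int) \<Rightarrow> real^'q \<Rightarrow> bool" where
  "covers f a y \<longleftrightarrow> (\<forall>j. 0 \<le> y $ j) \<and> (\<forall>i. of_int (a i) \<le> load f y i)"

definition defect :: "('q::finite \<Rightarrow> 'n set) \<Rightarrow> ('n \<Rightarrow> int) \<Rightarrow> real^'q \<Rightarrow> nat" where
  "defect f a y = card (fractional y) + card (slack f a y)"

text \<open>Move along \<open>z\<close> or \<open>- z\<close>, whichever does not raise the total,
  until a fractional value first meets an integer or a slack vertex becomes tight. Integral values
  and tight loads stay as they are, so the defect drops.\<close>

lemma covers_perturb:
  fixes f :: "'q::finite \<Rightarrow> 'n::finite set"
  assumes "covers f a y" "z \<noteq> 0"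
    and supp: "\<And>j. j \<notin> fractional y \<Longrightarrow> z $ j = 0"
    and tight: "\<And>i. i \<notin> slack f a y \<Longrightarrow> load f z i = 0"
  obtains y' where "covers f a y'" "(\<Sum>j\<in>UNIV. y' $ j) \<le> (\<Sum>j\<in>UNIV. y $ j)"
    "defect f a y' < defect f a y"
proof -
  \<comment> \<open>Quantified over \<open>z\<close> so that it serves for the given vector and for
    its negative.\<close>
  have main: "\<exists>y'. covers f a y' \<and> (\<Sum>j\<in>UNIV. y' $ j) \<le> (\<Sum>j\<in>UNIV. y $ j) \<and>
      defect f a y' < defect f a y"
    if neg: "(\<Sum>j\<in>UNIV. z $ j) \<le> 0" and nz: "z \<noteq> 0"
      and supp: "\<And>j. j \<notin> fractional y \<Longrightarrow> z $ j = 0"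
      and tight: "\<And>i. i \<notin> slack f a y \<Longrightarrow> load f z i = 0" for z
  proof -
    let ?F = "fractional y" and ?S = "slack f a y"
    \<comment> \<open>Distances to the floor, to the ceiling and to the demand, each with its rate
      of change. A fractional edge occurs with slopes \<open>z $ j\<close> and
      \<open>- z $ j\<close>, so a nonzero entry always supplies a decreasing function.\<close>
    define P where "P = (\<lambda>j. (y $ j - of_int \<lfloor>y $ j\<rfloor>, z $ j)) ` ?F
      \<union> (\<lambda>j. (of_int \<lceil>y $ j\<rceil> - y $ j, - z $ j)) ` ?F
      \<union> (\<lambda>i. (load f y i - of_int (a i), load f z i)) ` ?S"
    have P1: "(y $ j - of_int \<lfloor>y $ j\<rfloor>, z $ j) \<in> P"
        "(of_int \<lceil>y $ j\<rceil> - y $ j, - z $ j) \<in> P" if "j \<in> ?F" for j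
      using that by (auto simp: P_def)
    have P2: "(load f y i - of_int (a i), load f z i) \<in> P" if "i \<in> ?S" for i
      using that by (auto simp: P_def)
    have "finite P" by (simp add: P_def)
    moreover have "0 < c" if "(c, d) \<in> P" for c d
    proof -
      have "of_int \<lfloor>y $ j\<rfloor> < y $ j" "y $ j < of_int \<lceil>y $ j\<rceil>" if "j \<in> ?F" for j
        using that unfolding fractional_def
        by (metis Ints_of_int less_eq_real_def of_int_floor_le mem_Collect_eq,
            metis Ints_of_int less_eq_real_def le_of_int_ceiling mem_Collect_eq)
      moreover have "of_int (a i) < load f y i" if "i \<in> ?S" for i
        using that assms(1) by (auto simp: slack_def covers_def less_le)
      ultimately show ?thesis using that by (auto simp: P_def)
    qed
    moreover obtain c0 d0 where "(c0, d0) \<in> P" "d0 < 0"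
    proof -
      obtain j where j: "z $ j \<noteq> 0" using nz by (auto simp: vec_eq_iff)
      hence "j \<in> ?F" using supp by blast
      from P1[OF this] j show thesis
        by (cases "z $ j < 0") (auto intro: that)
    qed
    ultimately obtain t where t: "\<And>c d. (c, d) \<in> P \<Longrightarrow> 0 \<le> c + t * d"
      "\<exists>(c, d)\<in>P. c + t * d = 0" "0 < t"
      using first_hitting_time by metis
    define y' where "y' = y + t *\<^sub>R z"
    have y'F: "y' $ j = y $ j" if "j \<notin> ?F" for j
      using supp[OF that] by (simp add: y'_def)
    have y'S: "load f y' i = load f y i" if "i \<notin> ?S" for i
      using tight[OF that] by (simp add: y'_def load_simps)
    have fl: "of_int \<lfloor>y $ j\<rfloor> \<le> y' $ j" if "j \<in> ?F" for j
      using t(1)[OF P1(1)[OF that]] by (simp add: y'_def)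
    have subF: "fractional y' \<subseteq> ?F"
      using y'F by (force simp: fractional_def)
    have subS: "slack f a y' \<subseteq> ?S"
      using y'S by (force simp: slack_def)
    show ?thesis
    proof (intro exI conjI)
      show "covers f a y'"
        unfolding covers_def
      proof (intro conjI allI)
        fix j
        have "0 \<le> \<lfloor>y $ j\<rfloor>" using assms(1) by (simp add: covers_def)
        hence "j \<in> ?F \<Longrightarrow> 0 \<le> y' $ j" using fl[of j] by linarith
        thus "0 \<le> y' $ j"
          using y'F[of j] assms(1) by (cases "j \<in> ?F") (auto simp: covers_def)
      next
        fix i
        show "of_int (a i) \<le> load f y' i"
        proof (cases "i \<in> ?S")
          case True
          thus ?thesis using t(1)[OF P2[OF True]] by (simp add: y'_def load_simps)
        next
          case False
          thus ?thesis using y'S[of i] assms(1) by (auto simp: covers_def)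
        qed
      qed
      have "(\<Sum>j\<in>UNIV. y' $ j) = (\<Sum>j\<in>UNIV. y $ j) + t * (\<Sum>j\<in>UNIV. z $ j)"
        by (simp add: y'_def sum.distrib sum_distrib_left)
      thus "(\<Sum>j\<in>UNIV. y' $ j) \<le> (\<Sum>j\<in>UNIV. y $ j)"
        using neg t(3) by (simp add: mult_nonneg_nonpos)
      \<comment> \<open>The function that vanishes at time \<open>t\<close> tells which of the two
        sets loses an element.\<close>
      obtain c d where cd: "(c, d) \<in> P" "c + t * d = 0" using t(2) by auto
      from cd(1) have "fractional y' \<subset> ?F \<or> slack f a y' \<subset> ?S"
        unfolding P_def
      proof (elim UnE imageE)
        fix j assume j: "j \<in> ?F" "(c, d) = (y $ j - of_int \<lfloor>y $ j\<rfloor>, z $ j)"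
        hence "y' $ j = of_int \<lfloor>y $ j\<rfloor>" using cd(2) by (simp add: y'_def)
        hence "j \<notin> fractional y'" by (simp add: fractional_def)
        thus ?thesis using j subF by blast
      next
        fix j assume j: "j \<in> ?F" "(c, d) = (of_int \<lceil>y $ j\<rceil> - y $ j, - z $ j)"
        hence "y' $ j = of_int \<lceil>y $ j\<rceil>" using cd(2) by (simp add: y'_def)
        hence "j \<notin> fractional y'" by (simp add: fractional_def)
        thus ?thesis using j subF by blast
      next
        fix i assume i: "i \<in> ?S" "(c, d) = (load f y i - of_int (a i), load f z i)"
        hence "load f y' i = of_int (a i)" using cd(2) by (simp add: y'_def load_simps)
        hence "i \<notin> slack f a y'" by (simp add: slack_def)
        thus ?thesis using i subS by blast
      qed
      thus "defect f a y' < defect f a y"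
        unfolding defect_def
        using card_mono[OF _ subF] card_mono[OF _ subS]
        by (auto dest!: psubset_card_mono[OF finite] intro: add_less_le_mono add_le_less_mono)
    qed
  qed
  show ?thesis
  proof (cases "(\<Sum>j\<in>UNIV. z $ j) \<le> 0")
    case True
    thus ?thesis using main[of z] assms that by blast
  next
    case False
    hence "(\<Sum>j\<in>UNIV. (- z) $ j) \<le> 0" by (simp add: sum_negf)
    thus ?thesis using main[of "- z"] assms that by (auto simp: load_simps)
  qed
qed

section \<open>Cycles in 2-regular graphs\<close>

text \<open>A periodic sequence instead of a list: successors need no wrap-around, and shifting the
  index rotates the cycle. The bound \<open>3 \<le> k\<close> excludes going back and forth along
  one edge.\<close>

definition cycle_in :: "'v set set \<Rightarrow> (nat \<Rightarrow> 'v) \<Rightarrow> nat \<Rightarrow> bool" where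
  "cycle_in D s k \<longleftrightarrow> 3 \<le> k \<and> (\<forall>n. s (n + k) = s n) \<and> inj_on s {..<k} \<and>
     (\<forall>n. {s n, s (Suc n)} \<in> D)"

lemma cycle_in_mono: "cycle_in D s k \<Longrightarrow> D \<subseteq> D' \<Longrightarrow> cycle_in D' s k"
  by (auto simp: cycle_in_def)

context
  fixes D :: "'v set set" and s :: "nat \<Rightarrow> 'v" and k :: nat
  assumes cyc: "cycle_in D s k"
begin

lemma cycle_in_ge3: "3 \<le> k" and cycle_in_edge: "{s n, s (Suc n)} \<in> D"
  and cycle_in_period: "s (n + k) = s n"
  using cyc by (auto simp: cycle_in_def)

lemma cycle_in_period_mult: "s (n + m * k) = s n"
proof (induction m)
  case (Suc m)
  have "s (n + Suc m * k) = s (n + m * k + k)" by (simp add: algebra_simps)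
  thus ?case using Suc cycle_in_period by simp
qed simp

lemma cycle_in_mod: "s (n mod k) = s n"
  using cycle_in_period_mult[of "n mod k" "n div k"] by (simp add: add.commute mult.commute)

lemma cycle_in_eq_iff: "s m = s n \<longleftrightarrow> m mod k = n mod k"
proof
  assume "s m = s n"
  hence "s (m mod k) = s (n mod k)" by (simp add: cycle_in_mod)
  moreover have "0 < k" using cycle_in_ge3 by simp
  ultimately show "m mod k = n mod k"
    using cyc unfolding cycle_in_def inj_on_def by simp
qed (metis cycle_in_mod)

lemma cycle_in_range: "range s = s ` {..<k}"
proof -
  have "0 < k" using cycle_in_ge3 by simp
  thus ?thesis
    by (force simp: cycle_in_mod intro: rev_image_eqI[of "_ mod k"])
qed

lemma cycle_in_shift: "cycle_in D (\<lambda>n. s (i + n)) k"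
  unfolding cycle_in_def
proof (intro conjI allI inj_onI)
  fix m n assume "m \<in> {..<k}" "n \<in> {..<k}" "s (i + m) = s (i + n)"
  then obtain a b where "i + m + k * a = i + n + k * b"
    by (auto simp: cycle_in_eq_iff nat_mod_eq_iff)
  hence "m + k * a = n + k * b" by simp
  hence "m mod k = n mod k" unfolding nat_mod_eq_iff by blast
  with \<open>m \<in> {..<k}\<close> \<open>n \<in> {..<k}\<close> show "m = n" by simp
qed (use cycle_in_ge3 cycle_in_edge cycle_in_period[of "i + _"] in \<open>auto simp: add.assoc\<close>)

lemma cycle_in_edges_shift:
  "range (\<lambda>n. {s (i + n), s (Suc (i + n))}) = range (\<lambda>n. {s n, s (Suc n)})"
proof
  show "range (\<lambda>n. {s n, s (Suc n)}) \<subseteq> range (\<lambda>n. {s (i + n), s (Suc (i + n))})"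
  proof clarify
    fix n
    \<comment> \<open>Makes the truncated subtraction exact: \<open>n + i * k - i\<close> represents
      \<open>n - i\<close> modulo \<open>k\<close>.\<close>
    have "i \<le> i * k" using cycle_in_ge3 by simp
    hence "{s n, s (Suc n)} = {s (i + (n + i * k - i)), s (Suc (i + (n + i * k - i)))}"
      using cycle_in_period_mult[of n i] cycle_in_period_mult[of "Suc n" i]
      by (simp add: le_add_diff_inverse trans_le_add2)
    thus "{s n, s (Suc n)} \<in> range (\<lambda>n. {s (i + n), s (Suc (i + n))})" by blast
  qed
qed auto

text \<open>Two positions carrying the same edge in opposite directions would give
  \<open>2 mod k = 0\<close>, which \<open>3 \<le> k\<close> rules out.\<close>

lemma cycle_in_edge_inj:
  assumes "m < k" "n < k" "{s m, s (Suc m)} = {s n, s (Suc n)}"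
  shows "m = n"
proof -
  have *: False if "s (Suc p) = s q" "s (Suc q) = s p" "p < k" "q < k" for p q
  proof -
    from that have "(q + 2) mod k = q mod k"
      unfolding cycle_in_eq_iff by (metis add_2_eq_Suc' mod_Suc_eq)
    then obtain a b where "q + 2 + k * a = q + k * b"
      by (auto simp only: nat_mod_eq_iff)
    hence "2 + k * a = 0 + k * b" by simp
    hence "2 mod k = 0 mod k" unfolding nat_mod_eq_iff by blast
    thus False using cycle_in_ge3 by simp
  qed
  from assms(3) consider "s m = s n" | "s (Suc m) = s n" "s (Suc n) = s m"
    by (metis doubleton_eq_iff)
  thus ?thesis
  proof cases
    case 1
    thus ?thesis using assms unfolding cycle_in_eq_iff by simp
  qed (use * assms in blast)
qed

end

text \<open>The determinism of walking forward and backward in a 2-regular graph makes the walk return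
  to its starting point before it meets any other vertex twice.\<close>

lemma two_regular_cycle:
  fixes D :: "'v::finite set set"
  assumes D2: "\<And>E. E \<in> D \<Longrightarrow> card E = 2"
    and reg: "\<And>v E. E \<in> D \<Longrightarrow> v \<in> E \<Longrightarrow> card {E\<in>D. v \<in> E} = 2"
    and v0: "v0 \<in> \<Union>D"
  obtains s k where "cycle_in D s k" "s 0 = v0"
    "\<And>n E. E \<in> D \<Longrightarrow> s n \<in> E \<Longrightarrow> E \<in> range (\<lambda>n. {s n, s (Suc n)})"
    "\<And>n. {E\<in>D. s (Suc n) \<in> E} = {{s n, s (Suc n)}, {s (Suc n), s (Suc (Suc n))}}"
proof -
  define N where "N v = {u. {v, u} \<in> D}" for v
  have N_sym: "u \<in> N v \<longleftrightarrow> v \<in> N u" for u v by (simp add: N_def insert_commute)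
  have N_irrefl: "v \<notin> N v" for v using D2[of "{v}"] by (auto simp: N_def)
  have N_edges: "{E\<in>D. v \<in> E} = (\<lambda>u. {v, u}) ` N v" for v
  proof (intro equalityI subsetI)
    fix E assume E: "E \<in> {E\<in>D. v \<in> E}"
    then obtain a b where "E = {a, b}" using D2[of E] by (auto simp: card_2_iff)
    with E show "E \<in> (\<lambda>u. {v, u}) ` N v" by (auto simp: N_def insert_commute)
  qed (auto simp: N_def)
  have N2: "card (N v) = 2" if "v \<in> \<Union>D" for v
  proof -
    have "card ((\<lambda>u. {v, u}) ` N v) = card (N v)"
      by (intro card_image) (auto simp: inj_on_def doubleton_eq_iff)
    with that reg show ?thesis by (auto simp flip: N_edges)
  qed
  have N_D: "u \<in> \<Union>D" if "u \<in> N v" for u v using that by (auto simp: N_def)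
  obtain v1 where v1: "v1 \<in> N v0" using N2[OF v0] by (metis card.empty ex_in_conv zero_neq_numeral)
  define other where "other u v = (SOME w. w \<in> N v \<and> w \<noteq> u)" for u v
  have other: "other u v \<in> N v" "other u v \<noteq> u" if v: "v \<in> \<Union>D" for u v
  proof -
    obtain a b where "N v = {a, b}" "a \<noteq> b" using N2[OF v] by (auto simp: card_2_iff)
    hence "\<exists>w. w \<in> N v \<and> w \<noteq> u" by (cases "a = u") auto
    from someI_ex[OF this] show "other u v \<in> N v" "other u v \<noteq> u" by (auto simp: other_def)
  qed
  \<comment> \<open>The state is the pair of previous and current vertex, which determines the next
    one.\<close>
  define p where "p n = ((\<lambda>(u, v). (v, other u v)) ^^ n) (v0, v1)" for n
  define s where "s n = fst (p n)" for n
  have snd_p: "snd (p n) = s (Suc n)" for n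
    by (simp add: s_def p_def case_prod_beta)
  have s0: "s 0 = v0" and s1: "s 1 = v1" by (simp_all add: s_def p_def)
  have sSS: "s (Suc (Suc n)) = other (s n) (s (Suc n))" for n
    unfolding snd_p[of "Suc n", symmetric] using snd_p[of n]
    by (simp add: s_def p_def case_prod_beta)
  have next_N: "s (Suc n) \<in> N (s n)" for n
  proof (induction n)
    case 0
    show ?case using s0 s1 v1 by simp
  next
    case (Suc n)
    show ?case using other(1)[OF N_D[OF Suc]] by (simp add: sSS)
  qed
  have prev_N: "s n \<in> N (s (Suc n))" for n using next_N[of n] N_sym by blast
  have s_D: "s n \<in> \<Union>D" for n using prev_N N_D by blast
  have ne: "s (Suc (Suc n)) \<noteq> s n" for n
    unfolding sSS by (rule other(2)[OF s_D])
  have N_eq: "N v = {a, b}" if "a \<in> N v" "b \<in> N v" "a \<noteq> b" for v a b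
  proof -
    have "v \<in> \<Union>D" using that(1) by (auto simp: N_def)
    thus ?thesis using that card_subset_eq[of "N v" "{a, b}"] N2[of v] by simp
  qed
  have Nsuc: "N (s (Suc n)) = {s n, s (Suc (Suc n))}" for n
    using N_eq[OF prev_N next_N] ne by metis
  \<comment> \<open>The time of the first repetition, which exists because the vertex type is
    finite.\<close>
  define k where "k = (LEAST k. s k \<in> s ` {..<k})"
  have "\<exists>k. s k \<in> s ` {..<k}"
  proof -
    have "\<not> inj s" using finite_imageD[of s UNIV] by auto
    then obtain i j where "i < j" "s i = s j" unfolding inj_def by (metis linorder_neq_iff)
    thus ?thesis by (metis imageI lessThan_iff)
  qed
  hence "s k \<in> s ` {..<k}" unfolding k_def by (rule LeastI_ex)
  then obtain i where i: "i < k" "s k = s i" by auto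
  have least: "s j \<notin> s ` {..<j}" if "j < k" for j
    using that unfolding k_def by (rule not_less_Least)
  have inj: "inj_on s {..<k}"
    unfolding inj_on_def using least by (metis imageI lessThan_iff linorder_neq_iff)
  have step_ne: "s (Suc n) \<noteq> s n" for n using next_N N_irrefl by metis
  \<comment> \<open>Otherwise the vertex before \<open>s k\<close> is a neighbour of
    \<open>s i\<close>, hence equals the vertex before or after \<open>s i\<close>. Then a vertex
    repeats too early, or the walk backtracks or stands still.\<close>
  have i0: "i = 0"
  proof (rule ccontr)
    assume "i \<noteq> 0"
    then obtain h where h: "i = Suc h" by (cases i) auto
    obtain l where l: "k = Suc l" using i by (cases k) auto
    have "s l \<in> N (s i)" using prev_N[of l] i l by simp
    hence "s l = s h \<or> s l = s (Suc i)" using Nsuc h by simp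
    moreover have "s l \<noteq> s h" using inj_onD[OF inj, of l h] i h l by auto
    moreover have "s l \<noteq> s (Suc i)"
    proof
      assume eq: "s l = s (Suc i)"
      show False
      proof (cases "Suc i < k")
        case True
        hence "l = Suc i" using inj_onD[OF inj eq] l by simp
        thus False using ne[of i] i l by simp
      next
        case False
        hence "l = i" using i l by simp
        thus False using step_ne[of i] i l by simp
      qed
    qed
    ultimately show False by blast
  qed
  have k3: "3 \<le> k"
  proof -
    have "k \<noteq> 1" using i i0 step_ne[of 0] by auto
    moreover have "k \<noteq> 2" using i i0 ne[of 0] by (auto simp: numeral_2_eq_2)
    ultimately show ?thesis using i by simp
  qed
  then obtain l where l: "k = Suc l" by (cases k) auto
  \<comment> \<open>The neighbours of \<open>s k = s 0\<close> are \<open>s l\<close> and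
    \<open>s (Suc k)\<close>, and \<open>s 1\<close> differs from \<open>s l\<close>. Two
    consecutive matching vertices then propagate the period.\<close>
  have sk1: "s (Suc k) = s 1"
  proof -
    have "s 1 \<in> N (s k)" using next_N[of 0] i i0 by simp
    moreover have "s 1 \<noteq> s l" using inj_onD[OF inj, of 1 l] k3 l by auto
    ultimately show ?thesis using Nsuc[of l] l by auto
  qed
  have per: "s (n + k) = s n \<and> s (Suc n + k) = s (Suc n)" for n
  proof (induction n)
    case 0
    show ?case using i i0 sk1 by simp
  next
    case (Suc n)
    thus ?case using sSS[of "n + k"] sSS[of n] by simp
  qed
  have star: "{E\<in>D. s (Suc n) \<in> E} = {{s n, s (Suc n)}, {s (Suc n), s (Suc (Suc n))}}" for n
    unfolding N_edges Nsuc by (auto simp: insert_commute)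
  show ?thesis
  proof (rule that)
    show "cycle_in D s k"
      unfolding cycle_in_def
      using k3 per inj next_N by (auto simp: N_def)
    show "s 0 = v0" by (fact s0)
    show "{E\<in>D. s (Suc n) \<in> E} = {{s n, s (Suc n)}, {s (Suc n), s (Suc (Suc n))}}" for n
      by (fact star)
    fix n E assume E: "E \<in> D" "s n \<in> E"
    \<comment> \<open>\<open>star\<close> needs a vertex with a preceding index; adding a period
      supplies one even for \<open>n = 0\<close>.\<close>
    obtain m where m: "n + k = Suc m" using k3 by (cases "n + k") auto
    hence "E \<in> {E\<in>D. s (Suc m) \<in> E}" using E per[of n] by simp
    thus "E \<in> range (\<lambda>n. {s n, s (Suc n)})" unfolding star by auto
  qed
qed

section \<open>Vectors with alternating signs along a cycle\<close>

definition alternating :: "('q::finite \<Rightarrow> 'n set) \<Rightarrow> (nat \<Rightarrow> 'n) \<Rightarrow> nat \<Rightarrow> real^'q" where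
  "alternating f s k = (\<Sum>n<k. (- 1) ^ n *\<^sub>R axis (inv f {s n, s (Suc n)}) 1)"

lemma sum_axis: "(\<Sum>j\<in>UNIV. axis i (c :: real) $ j) = c"
  by (simp add: axis_def)

lemma alternating_nth:
  "alternating f s k $ j = (\<Sum>n | n < k \<and> inv f {s n, s (Suc n)} = j. (- 1) ^ n)"
proof -
  have "alternating f s k $ j = (\<Sum>n<k. if inv f {s n, s (Suc n)} = j then (- 1) ^ n else 0)"
    unfolding alternating_def sum_component by (intro sum.cong refl) (simp add: axis_def)
  thus ?thesis by (simp add: sum.If_cases Int_def)
qed

context
  fixes f :: "'q::finite \<Rightarrow> 'n set" and s :: "nat \<Rightarrow> 'n" and k :: nat
  assumes inj: "inj f" and cyc: "cycle_in (range f) s k"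
begin

lemma f_inv_edge: "f (inv f {s n, s (Suc n)}) = {s n, s (Suc n)}"
  using cycle_in_edge[OF cyc] by (rule f_inv_into_f)

lemma alternating_off_cycle:
  assumes "f j \<notin> range (\<lambda>n. {s n, s (Suc n)})"
  shows "alternating f s k $ j = 0"
proof -
  have "{n. n < k \<and> inv f {s n, s (Suc n)} = j} = {}"
    using assms f_inv_edge by blast
  thus ?thesis unfolding alternating_nth by (simp only: sum.empty)
qed

text \<open>By \<open>cycle_in_edge_inj\<close> exactly one index of a period names this edge, so
  nothing cancels.\<close>

lemma alternating_on_cycle:
  assumes "f j \<in> range (\<lambda>n. {s n, s (Suc n)})"
  shows "\<bar>alternating f s k $ j\<bar> = 1"
proof -
  obtain n where n: "f j = {s n, s (Suc n)}" using assms by auto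
  define m where "m = n mod k"
  have m: "m < k" using cycle_in_ge3[OF cyc] by (simp add: m_def)
  have "s m = s n" "s (Suc m) = s (Suc n)"
    by (simp_all add: cycle_in_eq_iff[OF cyc] m_def mod_Suc_eq)
  with n have fj: "f j = {s m, s (Suc m)}" by simp
  have "{n. n < k \<and> inv f {s n, s (Suc n)} = j} = {m}"
  proof (intro equalityI subsetI)
    fix n' assume "n' \<in> {n. n < k \<and> inv f {s n, s (Suc n)} = j}"
    hence "n' < k" "{s n', s (Suc n')} = {s m, s (Suc m)}"
      using f_inv_edge[of n'] fj by blast+
    thus "n' \<in> {m}" using cycle_in_edge_inj[OF cyc _ m] by blast
  next
    fix n' assume "n' \<in> {m}"
    moreover have "inv f {s m, s (Suc m)} = j"
      unfolding fj[symmetric] using inj by simp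
    ultimately show "n' \<in> {n. n < k \<and> inv f {s n, s (Suc n)} = j}"
      using m by blast
  qed
  thus ?thesis by (simp add: alternating_nth power_abs)
qed

text \<open>Consecutive signs cancel at every vertex other than \<open>s 0\<close>. There the first
  and the last edge meet, with equal signs exactly when \<open>k\<close> is odd.\<close>

lemma load_alternating:
  "load f (alternating f s k) i = (if odd k \<and> i = s 0 then 2 else 0)"
proof -
  have ne: "s (Suc n) \<noteq> s n" for n
  proof
    assume "s (Suc n) = s n"
    hence "Suc n mod k = n mod k" by (simp add: cycle_in_eq_iff[OF cyc])
    thus False using cycle_in_ge3[OF cyc] by (auto simp only: mod_Suc split: if_splits)
  qed
  \<comment> \<open>A walk of \<open>m\<close> edges leaves load only at its two ends; the separate
    term compensates for the open end \<open>s m\<close>.\<close>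
  have telescope: "(\<Sum>n<m. (- 1) ^ n * (if i \<in> {s n, s (Suc n)} then 1 else 0))
      + (- 1) ^ m * (if i = s m then 1 else 0) = (if i = s 0 then 1 else (0::real))" for m
    using ne ne[THEN not_sym] by (induction m) auto
  have "load f (alternating f s k) i
      = (\<Sum>n<k. (- 1) ^ n * (if i \<in> {s n, s (Suc n)} then 1 else 0))"
    unfolding alternating_def load_simps f_inv_edge ..
  also have "\<dots> = (if i = s 0 then 1 else 0) - (- 1) ^ k * (if i = s k then 1 else 0)"
    using telescope[of k] by linarith
  finally show ?thesis using cycle_in_period[OF cyc, of 0] by auto
qed

lemma sum_alternating: "(\<Sum>j\<in>UNIV. alternating f s k $ j) = (if odd k then 1 else 0)"
proof -
  have "(\<Sum>j\<in>UNIV. alternating f s k $ j)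
      = (\<Sum>n<k. (- 1) ^ n * (\<Sum>j\<in>UNIV. axis (inv f {s n, s (Suc n)}) 1 $ j))"
    unfolding alternating_def by (subst sum_component, subst sum.swap) (simp add: sum_distrib_left)
  also have "\<dots> = (\<Sum>n<k. (- 1) ^ n)" by (simp only: sum_axis mult_1_right)
  also have "\<dots> = (if odd k then 1 else 0)" by (induction k) auto
  finally show ?thesis .
qed

end

section \<open>Rounding covers\<close>

text \<open>The other edges contribute an integer. Hence at a tight vertex the fractional values
  alone have an integral sum.\<close>

lemma load_fractional:
  fixes f :: "'q::finite \<Rightarrow> 'n set"
  shows "load f y i - (\<Sum>j | j \<in> fractional y \<and> i \<in> f j. y $ j) \<in> \<int>"
proof -
  have "load f y i = (\<Sum>j | j \<in> fractional y \<and> i \<in> f j. y $ j)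
      + (\<Sum>j | j \<notin> fractional y \<and> i \<in> f j. y $ j)"
    unfolding load_def by (subst sum.union_disjoint[symmetric]) (auto intro!: sum.cong)
  moreover have "(\<Sum>j | j \<notin> fractional y \<and> i \<in> f j. y $ j) \<in> \<int>"
    by (intro Ints_sum) (simp add: fractional_def)
  ultimately show ?thesis by simp
qed

text \<open>Linear independence bounds the number of fractional edges by the number of tight vertices
  they meet, whereas integrality at a tight vertex forces fractional degree at least two. Double
  counting turns both bounds into equalities.\<close>

lemma minimal_defect_two_regular:
  fixes f :: "'q::finite \<Rightarrow> 'n::finite set"
  assumes card2: "\<And>j. card (f j) = 2"
    and y: "covers f a y"
    and min: "\<And>z. covers f a z \<Longrightarrow> (\<Sum>j\<in>UNIV. z $ j) \<le> (\<Sum>j\<in>UNIV. y $ j) \<Longrightarrow>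
      defect f a y \<le> defect f a z"
    and v: "v \<in> f j" "j \<in> fractional y"
  shows "v \<notin> slack f a y" "card {j\<in>fractional y. v \<in> f j} = 2"
proof -
  let ?F = "fractional y" and ?S = "slack f a y"
  define d where "d i = card {j\<in>?F. i \<in> f j}" for i
  define W where "W = \<Union>(f ` ?F)"
  have L: "linear (\<lambda>z. \<chi> i. load f z i)"
    by (auto simp: linear_iff vec_eq_iff load_simps)
  \<comment> \<open>Otherwise \<open>nontrivial_kernel\<close> yields a perturbation that lowers the
    defect. Only tight vertices in \<open>W\<close> impose equations, since fractional edges put no
    load outside \<open>W\<close>.\<close>
  have indep: "card ?F \<le> card (W - ?S)"
  proof (rule ccontr)
    assume "\<not> ?thesis"
    hence "card (W - ?S) < card ?F" by simp
    then obtain z where z: "z \<noteq> 0" "\<And>j. j \<notin> ?F \<Longrightarrow> z $ j = 0"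
      "\<And>i. i \<in> W - ?S \<Longrightarrow> (\<chi> i. load f z i) $ i = 0"
      using nontrivial_kernel[OF L] by blast
    have "load f z i = 0" if i: "i \<notin> ?S" for i
    proof (cases "i \<in> W")
      case True
      thus ?thesis using z(3) i by simp
    next
      case False
      thus ?thesis unfolding load_def
        by (intro sum.neutral) (use z(2) in \<open>auto simp: W_def\<close>)
    qed
    from covers_perturb[OF y z(1,2) this] min show False
      by (metis not_less)
  qed
  have d1: "1 \<le> d i" if i: "i \<in> W" for i
    using i by (auto simp: W_def d_def Suc_le_eq card_gt_0_iff)
  \<comment> \<open>The value of a lone fractional edge at a tight vertex would be a difference of
    integers.\<close>
  have d2: "2 \<le> d i" if i: "i \<in> W - ?S" for i
  proof (rule ccontr)
    assume "\<not> ?thesis"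
    hence "d i = 1" using d1 i by fastforce
    then obtain j where j: "{j\<in>?F. i \<in> f j} = {j}" by (auto simp: d_def card_1_singleton_iff)
    have "load f y i \<in> \<int>" using i by (simp add: slack_def)
    moreover have "load f y i - y $ j \<in> \<int>" using load_fractional[of f y i] j by simp
    ultimately have "load f y i - (load f y i - y $ j) \<in> \<int>" by (rule Ints_diff)
    thus False using j by (auto simp: fractional_def)
  qed
  have "(\<Sum>i\<in>W. d i) = (\<Sum>j\<in>?F. card (f j))"
  proof -
    have "(\<Sum>i\<in>W. d i) = (\<Sum>i\<in>W. \<Sum>j\<in>?F. if i \<in> f j then 1 else 0)"
      by (simp add: d_def sum.If_cases Int_def)
    also have "\<dots> = (\<Sum>j\<in>?F. \<Sum>i\<in>W. if i \<in> f j then 1 else 0)" by (rule sum.swap)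
    also have "\<dots> = (\<Sum>j\<in>?F. card (f j))"
    proof (intro sum.cong refl)
      fix j assume "j \<in> ?F"
      hence "{i\<in>W. i \<in> f j} = f j" by (auto simp: W_def)
      thus "(\<Sum>i\<in>W. if i \<in> f j then 1 else 0) = card (f j)"
        by (simp add: sum.If_cases Int_def)
    qed
    finally show ?thesis .
  qed
  hence total: "(\<Sum>i\<in>W. d i) = 2 * card ?F" by (simp add: card2)
  have split: "(\<Sum>i\<in>W. d i) = (\<Sum>i\<in>W - ?S. d i) + (\<Sum>i\<in>W \<inter> ?S. d i)"
    using sum.Int_Diff[of W d ?S] by simp
  \<comment> \<open>The degree sum is \<open>2 * card ?F\<close>, at most
    \<open>2 * card (W - ?S)\<close> by \<open>indep\<close>, and at least
    \<open>2 * card (W - ?S) + card (W \<inter> ?S)\<close>. So equality holds throughout.\<close>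
  have "2 * card (W - ?S) \<le> (\<Sum>i\<in>W - ?S. d i)"
    using sum_mono[of "W - ?S" "\<lambda>_. 2" d] d2 by simp
  moreover have "card (W \<inter> ?S) \<le> (\<Sum>i\<in>W \<inter> ?S. d i)"
    using sum_mono[of "W \<inter> ?S" "\<lambda>_. 1" d] d1 by simp
  ultimately have WS: "card (W \<inter> ?S) = 0" and eq: "(\<Sum>i\<in>W - ?S. d i) = 2 * card (W - ?S)"
    using total split indep by linarith+
  have "v \<in> W" using v by (auto simp: W_def)
  thus vS: "v \<notin> ?S" using WS by auto
  show "card {j\<in>?F. v \<in> f j} = 2"
  proof (rule ccontr)
    assume "\<not> ?thesis"
    hence "2 < d v" using d2[of v] \<open>v \<in> W\<close> vS by (simp add: d_def)
    hence "(\<Sum>i\<in>W - ?S. 2) < (\<Sum>i\<in>W - ?S. d i)"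
      using d2 \<open>v \<in> W\<close> vS by (intro sum_strict_mono_ex1) auto
    thus False using eq by simp
  qed
qed

text \<open>Modulo one, each value is the negative of the preceding one. After an odd number of
  steps round the cycle, a value is congruent to its own negative.\<close>

lemma cycle_half_integral:
  assumes inj: "inj f" and cyc: "cycle_in (range f) s k" and k: "odd k"
    and consec: "\<And>n. y $ inv f {s n, s (Suc n)} + y $ inv f {s (Suc n), s (Suc (Suc n))} \<in> \<int>"
    and j: "f j \<in> range (\<lambda>n. {s n, s (Suc n)})"
  shows "y $ j + y $ j \<in> (\<int> :: real set)"
proof -
  obtain m where "f j = {s m, s (Suc m)}" using j by auto
  hence m: "inv f {s m, s (Suc m)} = j" using inj by (metis inv_f_f)
  define c where "c n = y $ inv f {s n, s (Suc n)}" for n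
  have "c (m + n) - (- 1) ^ n * c m \<in> \<int>" for n
  proof (induction n)
    case (Suc n)
    have "(c (m + n) + c (Suc (m + n))) - (c (m + n) - (- 1) ^ n * c m) \<in> \<int>"
      by (rule Ints_diff) (use Suc consec[of "m + n"] in \<open>simp_all add: c_def\<close>)
    thus ?case by simp
  qed simp
  from this[of k] have "c m + c m \<in> \<int>"
    using cycle_in_period[OF cyc, of m] cycle_in_period[OF cyc, of "Suc m"] k
    by (simp add: c_def)
  thus ?thesis by (simp add: c_def m)
qed

lemma half_integer_shift:
  fixes x w :: real
  assumes "x \<notin> \<int>" "x + x \<in> \<int>" "\<bar>w\<bar> = 1"
  shows "x + w / 2 \<in> \<int>"
proof -
  obtain m where m: "x + x = of_int m" using assms(2) by (auto elim: Ints_cases)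
  have "odd m"
  proof
    assume "even m"
    then obtain q where "m = 2 * q" by blast
    hence "x = of_int q" using m by simp
    thus False using assms(1) by simp
  qed
  then obtain q where q: "m = 2 * q + 1" by (rule oddE)
  have "w = 1 \<or> w = - 1" using assms(3) by linarith
  hence "x + w / 2 = of_int (q + 1) \<or> x + w / 2 = of_int q" using m q by auto
  thus ?thesis by (metis Ints_of_int)
qed

text \<open>Rounding lowers a nonnegative value by at most one half, so integrality of the result
  already gives nonnegativity.\<close>

lemma Ints_ge_neg_half:
  fixes x :: real
  assumes "x \<in> \<int>" "- 1 / 2 \<le> x"
  shows "0 \<le> x"
  using assms by (auto elim!: Ints_cases)

text \<open>Rounding up a single odd cycle costs one half. The total before was half an odd integer, so
  the integral bound \<open>M\<close> leaves room for it.\<close>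

theorem integral_cover:
  fixes f :: "'q::finite \<Rightarrow> 'n::finite set" and M :: int
  assumes inj: "inj f" and card2: "\<And>j. card (f j) = 2"
    and joined: "\<And>s k t l. cycle_in (range f) s k \<Longrightarrow> cycle_in (range f) t l \<Longrightarrow>
      odd k \<Longrightarrow> odd l \<Longrightarrow> range s \<inter> range t = {} \<Longrightarrow> \<exists>m n. {s m, t n} \<in> range f"
    and y0: "covers f a y0" "(\<Sum>j\<in>UNIV. y0 $ j) \<le> of_int M"
  shows "\<exists>y. covers f a y \<and> (\<forall>j. y $ j \<in> \<int>) \<and> (\<Sum>j\<in>UNIV. y $ j) \<le> of_int M"
proof -
  have result: ?thesis
    if "covers f a y" "\<And>j. y $ j \<in> \<int>" "(\<Sum>j\<in>UNIV. y $ j) \<le> of_int M" for y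
    using that by blast
  obtain y where y: "covers f a y" "(\<Sum>j\<in>UNIV. y $ j) \<le> of_int M"
    and min: "\<And>z. covers f a z \<Longrightarrow> (\<Sum>j\<in>UNIV. z $ j) \<le> of_int M \<Longrightarrow> defect f a y \<le> defect f a z"
    using ex_has_least_nat[of "\<lambda>y. covers f a y \<and> (\<Sum>j\<in>UNIV. y $ j) \<le> of_int M" y0 "defect f a"] y0
    by blast
  define F where "F = fractional y"
  define D where "D = f ` F"
  have min': "defect f a y \<le> defect f a z"
    if "covers f a z" "(\<Sum>j\<in>UNIV. z $ j) \<le> (\<Sum>j\<in>UNIV. y $ j)" for z
    using min that y(2) by force
  have tight: "v \<notin> slack f a y" and deg2: "card {j\<in>F. v \<in> f j} = 2"
    if "v \<in> f j" "j \<in> F" for v j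
    using minimal_defect_two_regular[OF card2 y(1) min' that[unfolded F_def]]
    by (simp_all add: F_def)
  have D_iff: "f j \<in> D \<longleftrightarrow> j \<in> F" for j
    using inj by (auto simp: D_def inj_def)
  have star: "{E\<in>D. v \<in> E} = f ` {j\<in>F. v \<in> f j}" for v by (auto simp: D_def)
  have card_star: "card {E\<in>D. v \<in> E} = 2" if "E \<in> D" "v \<in> E" for v E
  proof -
    have "card (f ` {j\<in>F. v \<in> f j}) = card {j\<in>F. v \<in> f j}"
      using inj by (intro card_image) (auto simp: inj_on_def inj_def)
    thus ?thesis using that deg2 unfolding star by (auto simp: D_def)
  qed
  have card_D: "card E = 2" if "E \<in> D" for E using that card2 by (auto simp: D_def)
  \<comment> \<open>The condition on \<open>E\<close> makes the cycle a whole component of the graph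
    of fractional edges.\<close>
  define fractional_cycle where "fractional_cycle s k \<longleftrightarrow> cycle_in D s k \<and> odd k \<and>
    (\<forall>n E. E \<in> D \<longrightarrow> s n \<in> E \<longrightarrow> E \<in> range (\<lambda>n. {s n, s (Suc n)})) \<and>
    (\<forall>j. f j \<in> range (\<lambda>n. {s n, s (Suc n)}) \<longrightarrow> y $ j + y $ j \<in> \<int>)" for s k
  have D_range: "D \<subseteq> range f" by (auto simp: D_def)
  have off: "f j \<notin> range (\<lambda>n. {s n, s (Suc n)})" if "cycle_in D s k" "j \<notin> F" for s k j
  proof
    assume "f j \<in> range (\<lambda>n. {s n, s (Suc n)})"
    then obtain n where "f j = {s n, s (Suc n)}" by blast
    hence "f j \<in> D" using cycle_in_edge[OF that(1), of n] by simp
    thus False using that(2) D_iff by blast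
  qed
  have ex_cycle: "\<exists>s k. fractional_cycle s k \<and> s 0 = v" if v: "v \<in> \<Union>D" for v
  proof (rule two_regular_cycle[of D v])
    fix s k
    assume s: "cycle_in D s k" "s 0 = v"
      "\<And>n E. E \<in> D \<Longrightarrow> s n \<in> E \<Longrightarrow> E \<in> range (\<lambda>n. {s n, s (Suc n)})"
      "\<And>n. {E\<in>D. s (Suc n) \<in> E} = {{s n, s (Suc n)}, {s (Suc n), s (Suc (Suc n))}}"
    note cyc = cycle_in_mono[OF s(1) D_range]
    \<comment> \<open>On an even cycle the alternating vector has zero load everywhere and would be
      a perturbation lowering the defect.\<close>
    have k: "odd k"
    proof
      assume k: "even k"
      define z where "z = alternating f s k"
      define j where "j = inv f {s 0, s 1}"
      have "f j = {s 0, s 1}" using f_inv_edge[OF inj cyc, of 0] by (simp add: j_def)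
      hence "\<bar>z $ j\<bar> = 1"
        unfolding z_def by (intro alternating_on_cycle[OF inj cyc]) auto
      hence "z \<noteq> 0" by auto
      moreover have "z $ j = 0" if "j \<notin> fractional y" for j
        unfolding z_def using off[OF s(1)] that
        by (intro alternating_off_cycle[OF inj cyc]) (simp add: F_def)
      moreover have "load f z i = 0" for i
        using k by (simp add: z_def load_alternating[OF inj cyc])
      ultimately obtain z' where "covers f a z'" "(\<Sum>j\<in>UNIV. z' $ j) \<le> (\<Sum>j\<in>UNIV. y $ j)"
        "defect f a z' < defect f a y"
        using covers_perturb[OF y(1)] by metis
      thus False using min' by (simp add: leD)
    qed
    \<comment> \<open>By \<open>s(4)\<close> the two cycle edges are the only fractional ones at
      this vertex, and degree two makes them distinct. Tightness makes their sum integral.\<close>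
    have consec: "y $ inv f {s n, s (Suc n)} + y $ inv f {s (Suc n), s (Suc (Suc n))} \<in> \<int>" for n
    proof -
      let ?v = "s (Suc n)" and ?i = "inv f {s n, s (Suc n)}"
        and ?j = "inv f {s (Suc n), s (Suc (Suc n))}"
      have "{s n, ?v} \<in> D" by (rule cycle_in_edge[OF s(1)])
      then obtain j where j: "?v \<in> f j" "j \<in> F" by (auto simp: D_def)
      have "f ` {j\<in>F. ?v \<in> f j} = f ` {?i, ?j}"
        unfolding star[symmetric] s(4) by (simp add: f_inv_edge[OF inj cyc])
      hence eq: "{j\<in>F. ?v \<in> f j} = {?i, ?j}" using inj by (simp only: inj_image_eq_iff)
      have "?i \<noteq> ?j"
      proof
        assume "?i = ?j"
        with deg2[OF j] show False unfolding eq by simp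
      qed
      hence "(\<Sum>j | j \<in> fractional y \<and> ?v \<in> f j. y $ j) = y $ ?i + y $ ?j"
        using eq by (simp add: F_def)
      moreover have "load f y ?v \<in> \<int>" using tight[OF j] by (simp add: slack_def)
      ultimately show ?thesis using Ints_diff[of "load f y ?v"] load_fractional[of f y ?v] by fastforce
    qed
    have "y $ j + y $ j \<in> \<int>" if "f j \<in> range (\<lambda>n. {s n, s (Suc n)})" for j
      using cycle_half_integral[OF inj cyc k consec that] .
    with s k show ?thesis unfolding fractional_cycle_def by blast
  qed (fact card_D card_star v)+
  have ne_Int: "y $ j \<notin> \<int>" if "j \<in> F" for j using that by (simp add: F_def fractional_def)
  have Int: "y $ j \<in> \<int>" if "j \<notin> F" for j using that by (simp add: F_def fractional_def)
  have y_nonneg: "0 \<le> y $ j" for j using y(1) by (simp add: covers_def)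
  have y_load: "of_int (a i) \<le> load f y i" for i using y(1) by (simp add: covers_def)
  show ?thesis
  proof (cases "F = {}")
    case True
    thus ?thesis using result[OF y(1) _ y(2)] Int by blast
  next
    case False
    then obtain j where "j \<in> F" by blast
    moreover have "f j \<noteq> {}" using card2[of j] by auto
    ultimately obtain v where "v \<in> \<Union>D" by (auto simp: D_def)
    then obtain s k where s: "fractional_cycle s k" using ex_cycle by blast
    hence sD: "cycle_in D s k" and k: "odd k"
      and sE: "\<And>n E. E \<in> D \<Longrightarrow> s n \<in> E \<Longrightarrow> E \<in> range (\<lambda>n. {s n, s (Suc n)})"
      and s_half: "\<And>j. f j \<in> range (\<lambda>n. {s n, s (Suc n)}) \<Longrightarrow> y $ j + y $ j \<in> \<int>"
      unfolding fractional_cycle_def by blast+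
    note cyc = cycle_in_mono[OF sD D_range]
    show ?thesis
    proof (cases "D \<subseteq> range (\<lambda>n. {s n, s (Suc n)})")
      case D_sub: True
      define w where "w = alternating f s k"
      \<comment> \<open>All fractional edges lie on this cycle. The half step makes them integral,
        raises the load at \<open>s 0\<close> by one and the total by one half.\<close>
      define y' where "y' = y + (1 / 2) *\<^sub>R w"
      have y'_Int: "y' $ j \<in> \<int>" for j
      proof (cases "j \<in> F")
        case True
        hence fj: "f j \<in> range (\<lambda>n. {s n, s (Suc n)})"
          using D_sub D_iff by blast
        have "\<bar>w $ j\<bar> = 1" unfolding w_def by (rule alternating_on_cycle[OF inj cyc fj])
        from half_integer_shift[OF ne_Int[OF True] s_half[OF fj] this]
        show ?thesis by (simp add: y'_def)
      next
        case False
        hence "w $ j = 0"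
          unfolding w_def using off[OF sD] by (intro alternating_off_cycle[OF inj cyc]) blast
        thus ?thesis using Int[OF False] by (simp add: y'_def)
      qed
      have w_ge: "- 1 \<le> w $ j" for j
        using alternating_on_cycle[OF inj cyc, of j] alternating_off_cycle[OF inj cyc, of j]
        unfolding w_def by force
      have sum: "(\<Sum>j\<in>UNIV. y' $ j) = (\<Sum>j\<in>UNIV. y $ j) + 1 / 2"
        using sum_alternating[OF inj cyc] k
        by (simp add: y'_def w_def sum.distrib flip: sum_divide_distrib)
      show ?thesis
      proof (rule result)
        show "covers f a y'"
          unfolding covers_def
        proof (intro conjI allI)
          fix j
          have "- 1 / 2 \<le> y' $ j" using y_nonneg[of j] w_ge[of j] by (simp add: y'_def)
          thus "0 \<le> y' $ j" by (rule Ints_ge_neg_half[OF y'_Int])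
        next
          fix i
          show "of_int (a i) \<le> load f y' i"
            using y_load[of i] load_alternating[OF inj cyc, of i]
            by (auto simp: y'_def w_def load_simps)
        qed
        have "(\<Sum>j\<in>UNIV. y' $ j) \<in> \<int>" using y'_Int by (intro Ints_sum) auto
        then obtain N where N: "(\<Sum>j\<in>UNIV. y' $ j) = of_int N" by (rule Ints_cases)
        \<comment> \<open>The new total is an integer of size at most \<open>M + 1 / 2\<close>,
          hence at most \<open>M\<close>.\<close>
        hence "real_of_int N < of_int (M + 1)" using sum y(2) by simp
        thus "(\<Sum>j\<in>UNIV. y' $ j) \<le> of_int M" unfolding N of_int_less_iff by simp
      qed (fact y'_Int)
    next
      case False
      \<comment> \<open>A fractional edge off the first cycle leads to a second one. Rounding both
        together will contradict the minimal defect.\<close>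
      then obtain E where E: "E \<in> D" "E \<notin> range (\<lambda>n. {s n, s (Suc n)})" by blast
      moreover have "E \<noteq> {}" using card_D[OF E(1)] by auto
      ultimately obtain u where u: "u \<in> E" "u \<in> \<Union>D" by blast
      then obtain t l where t: "fractional_cycle t l" "t 0 = u" using ex_cycle by blast
      hence tD: "cycle_in D t l" and l: "odd l"
        and t_half: "\<And>j. f j \<in> range (\<lambda>n. {t n, t (Suc n)}) \<Longrightarrow> y $ j + y $ j \<in> \<int>"
        unfolding fractional_cycle_def by blast+
      have u_notin: "u \<notin> range s" using sE E u(1) by blast
      have disj: "range s \<inter> range t = {}"
      proof (rule ccontr)
        assume "\<not> ?thesis"
        then obtain z where "z \<in> range s" "z \<in> range t" by blast
        then obtain n where n: "t n \<in> range s" by (metis imageE)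
        \<comment> \<open>A fractional edge meeting the first cycle belongs to it, so
          \<open>t\<close> could never leave \<open>range s\<close>, yet it returns to
          \<open>u\<close>.\<close>
        have step: "t (n + i) \<in> range s" for i
        proof (induction i)
          case (Suc i)
          obtain h where h: "t (n + i) = s h" using Suc by blast
          have "{t (n + i), t (Suc (n + i))} \<in> D" by (rule cycle_in_edge[OF tD])
          hence "{t (n + i), t (Suc (n + i))} \<in> range (\<lambda>n. {s n, s (Suc n)})"
            by (rule sE[of _ h]) (simp add: h)
          thus ?case by (auto simp: doubleton_eq_iff)
        qed (use n in simp)
        have "n \<le> n * l" using cycle_in_ge3[OF tD] by simp
        hence "t (n + (n * l - n)) = u"
          using cycle_in_period_mult[OF tD, of 0 n] t(2) by simp
        thus False using step[of "n * l - n"] u_notin by simp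
      qed
      have disj': "s i \<noteq> t i'" for i i' using disj by blast
      note cyc_t = cycle_in_mono[OF tD D_range]
      obtain m n where mn: "{s m, t n} \<in> range f"
        using joined[OF cyc cyc_t k l disj] by blast
      then obtain b where b: "f b = {s m, t n}" by force
      \<comment> \<open>The rotations put the base points, where the alternating vectors change the
        load, at the ends of the joining edge \<open>b\<close>.\<close>
      define s' where "s' i = s (m + i)" for i
      define t' where "t' i = t (n + i)" for i
      have s'D: "cycle_in D s' k" and t'D: "cycle_in D t' l"
        unfolding s'_def t'_def by (rule cycle_in_shift[OF sD], rule cycle_in_shift[OF tD])
      note cyc' = cycle_in_mono[OF s'D D_range] and cyc_t' = cycle_in_mono[OF t'D D_range]
      have s'_edges: "range (\<lambda>i. {s' i, s' (Suc i)}) = range (\<lambda>i. {s i, s (Suc i)})"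
        and t'_edges: "range (\<lambda>i. {t' i, t' (Suc i)}) = range (\<lambda>i. {t i, t (Suc i)})"
        using cycle_in_edges_shift[OF sD, of m] cycle_in_edges_shift[OF tD, of n]
        by (simp_all add: s'_def t'_def)
      define S where "S = range (\<lambda>i. {s i, s (Suc i)})"
      define T where "T = range (\<lambda>i. {t i, t (Suc i)})"
      have ST: "S \<inter> T = {}" "{s m, t n} \<notin> S" "{s m, t n} \<notin> T"
        using disj' disj'[THEN not_sym] by (auto simp: S_def T_def doubleton_eq_iff)
      define w where "w = alternating f s' k"
      define z where "z = alternating f t' l"
      have w_on: "\<bar>w $ j\<bar> = 1" if "f j \<in> S" for j
        using alternating_on_cycle[OF inj cyc', of j] that by (simp add: w_def s'_edges S_def)
      have w_off: "w $ j = 0" if "f j \<notin> S" for j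
        using alternating_off_cycle[OF inj cyc', of j] that by (simp add: w_def s'_edges S_def)
      have z_on: "\<bar>z $ j\<bar> = 1" if "f j \<in> T" for j
        using alternating_on_cycle[OF inj cyc_t', of j] that by (simp add: z_def t'_edges T_def)
      have z_off: "z $ j = 0" if "f j \<notin> T" for j
        using alternating_off_cycle[OF inj cyc_t', of j] that by (simp add: z_def t'_edges T_def)
      \<comment> \<open>Each half vector takes one unit of load from its base point and one half
        from the total. Raising \<open>b\<close> by one restores both loads and the total.\<close>
      define y' where "y' = y - (1 / 2) *\<^sub>R w - (1 / 2) *\<^sub>R z + axis b 1"
      have y'_other: "y' $ j = y $ j + (if j = b then 1 else 0)" if "f j \<notin> S" "f j \<notin> T" for j
        using that w_off[of j] z_off[of j] by (simp add: y'_def axis_def)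
      have in_F: "j \<in> F" if "f j \<in> S \<or> f j \<in> T" for j
        using that off[OF sD, of j] off[OF tD, of j] by (auto simp: S_def T_def)
      have y'_on: "y' $ j \<in> \<int> \<and> 0 \<le> y' $ j" if "f j \<in> S \<or> f j \<in> T" for j
      proof -
        define c where "c = (if f j \<in> S then - w $ j else - z $ j)"
        have "j \<noteq> b" using that ST(2,3) by (auto simp: b)
        hence eq: "y' $ j = y $ j + c / 2"
          using that ST(1) w_off[of j] z_off[of j] by (auto simp: y'_def axis_def c_def)
        have c: "\<bar>c\<bar> = 1" using that w_on[of j] z_on[of j] by (auto simp: c_def)
        have "y $ j + y $ j \<in> \<int>" using that s_half[of j] t_half[of j] by (auto simp: S_def T_def)
        hence int: "y' $ j \<in> \<int>"
          unfolding eq by (rule half_integer_shift[OF ne_Int[OF in_F[OF that]] _ c])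
        have "- 1 / 2 \<le> y' $ j" using y_nonneg[of j] c unfolding eq by linarith
        thus ?thesis using int Ints_ge_neg_half by blast
      qed
      have load': "load f y' i = load f y i" for i
      proof -
        have "s m \<noteq> t n" using disj by blast
        thus ?thesis
          using load_alternating[OF inj cyc', of i] load_alternating[OF inj cyc_t', of i] k l
          by (auto simp: y'_def w_def z_def load_simps b s'_def t'_def)
      qed
      have "covers f a y'"
        unfolding covers_def load'
      proof (intro conjI allI)
        fix j show "0 \<le> y' $ j"
          using y_nonneg[of j] y'_on[of j] y'_other[of j]
          by (cases "f j \<in> S \<or> f j \<in> T") auto
      qed (fact y_load)
      moreover have "(\<Sum>j\<in>UNIV. y' $ j) = (\<Sum>j\<in>UNIV. y $ j)"
        using sum_alternating[OF inj cyc'] sum_alternating[OF inj cyc_t'] k l sum_axis[of b 1]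
        by (simp add: y'_def w_def z_def sum.distrib sum_subtractf flip: sum_divide_distrib)
      ultimately have le: "defect f a y \<le> defect f a y'" using min' by simp
      have "slack f a y' = slack f a y" by (simp add: slack_def load')
      moreover have "fractional y' \<subset> F"
      proof -
        have "fractional y' \<subseteq> F"
        proof
          fix j assume j: "j \<in> fractional y'"
          show "j \<in> F"
          proof (rule ccontr)
            assume "j \<notin> F"
            hence "y' $ j = y $ j + (if j = b then 1 else 0)" "y $ j \<in> \<int>"
              using in_F[of j] y'_other[of j] Int by blast+
            thus False using j by (simp add: fractional_def split: if_splits)
          qed
        qed
        \<comment> \<open>An edge of the first cycle, fractional before and integral now, witnesses
          strictness.\<close>
        moreover obtain j where j: "{s 0, s (Suc 0)} = f j"
          using cycle_in_edge[OF cyc, of 0] by blast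
        have "f j \<in> S" unfolding S_def j[symmetric] by (rule rangeI)
        hence "j \<in> F" "j \<notin> fractional y'"
          using in_F[of j] y'_on[of j] by (simp_all add: fractional_def)
        ultimately show ?thesis by blast
      qed
      ultimately have "defect f a y' < defect f a y"
        unfolding defect_def F_def by (simp add: psubset_card_mono)
      with le show ?thesis by simp
    qed
  qed
qed

section \<open>Cycles of a graph as walks and as sequences\<close>

context graph
begin

lemma edges_iff: "{u, v} \<in> edges G \<longleftrightarrow> (u, v) \<in> arcs_ends G"
proof
  assume "{u, v} \<in> edges G"
  then obtain a where "a \<in> arcs G" "{tail G a, head G a} = {u, v}" by (auto simp: edges_def)
  hence "(u, v) \<in> arcs_ends G \<or> (v, u) \<in> arcs_ends G"
    by (auto simp: arcs_ends_conv doubleton_eq_iff)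
  thus "(u, v) \<in> arcs_ends G" using graph_symmetric by blast
qed (auto simp: edges_def arcs_ends_conv)

lemma edgesE:
  assumes "E \<in> edges G"
  obtains u v where "E = {u, v}" "u \<noteq> v"
  using assms no_loops by (auto simp: edges_def)

text \<open>Choose an arc over each step of one period. The heads run through the period shifted by
  one, so they are distinct.\<close>

lemma cycle_in_imp_cycle:
  assumes cyc: "cycle_in (edges G) s k"
  obtains p where "cycle p" "length p = k" "cycle_verts G p = range s"
proof -
  have "\<exists>a. a \<in> arcs G \<and> tail G a = s n \<and> head G a = s (Suc n)" for n
    using cycle_in_edge[OF cyc, of n] unfolding edges_iff by (auto simp: arcs_ends_conv)
  then obtain c where c: "c n \<in> arcs G" "tail G (c n) = s n" "head G (c n) = s (Suc n)" for n
    by metis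
  define p where "p = map c [0..<k]"
  have cas: "cas (s m) (map c [m..<m + n]) (s (m + n))" for m n
  proof (induction n arbitrary: m)
    case (Suc n)
    have "[m..<m + Suc n] = m # [Suc m..<Suc m + n]" by (simp add: upt_conv_Cons)
    thus ?case using Suc[of "Suc m"] by (simp add: c)
  qed simp
  have k: "3 \<le> k" by (rule cycle_in_ge3[OF cyc])
  have cas_p: "cas (s 0) p (s 0)"
    using cas[of 0 k] cycle_in_period[OF cyc, of 0] by (simp add: p_def)
  have s0: "s 0 \<in> verts G" using c[of 0] by (metis tail_in_verts)
  have "p \<noteq> []" using k by (simp add: p_def)
  hence "tl (awalk_verts (s 0) p) = map (head G) p"
    by (simp add: awalk_verts_conv'[OF cas_p])
  also have "\<dots> = map (\<lambda>n. s (1 + n)) [0..<k]" by (simp add: p_def c)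
  finally have "tl (awalk_verts (s 0) p) = map (\<lambda>n. s (1 + n)) [0..<k]" .
  moreover have "inj_on (\<lambda>n. s (1 + n)) {..<k}"
    using cycle_in_shift[OF cyc, of 1] by (simp add: cycle_in_def)
  ultimately have "distinct (tl (awalk_verts (s 0) p))"
    by (simp add: distinct_map atLeast0LessThan)
  hence "cycle p"
    unfolding cycle_def awalk_def using cas_p s0 k c(1) by (auto simp: p_def intro!: exI[of _ "s 0"])
  moreover have "cycle_verts G p = range s"
    unfolding cycle_in_range[OF cyc] by (simp add: cycle_verts_def p_def image_image c atLeast0LessThan)
  ultimately show ?thesis by (intro that[of p]) (auto simp: p_def)
qed

text \<open>The base vertex is the tail of the first arc and the head of the last, so heads and
  tails cover the same vertices. The heads are listed without repetition.\<close>

lemma cycle_verts_eq_heads: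
  assumes "cycle p"
  shows "cycle_verts G p = head G ` set p" "card (cycle_verts G p) = length p"
    "distinct p" "set p \<subseteq> arcs G"
proof -
  obtain u where u: "awalk u p u" "distinct (tl (awalk_verts u p))" "p \<noteq> []" "distinct p"
    using assms unfolding cycle_conv by blast
  hence cas: "cas u p u" by auto
  have tl: "tl (awalk_verts u p) = map (head G) p"
    using u(3) by (simp add: awalk_verts_conv'[OF cas])
  have "u = head G (last p)"
    using awlast_if_cas[OF cas] u(3) by (simp add: awalk_verts_conv)
  moreover have "tail G (hd p) = u" using cas u(3) by (simp add: cas_simp)
  moreover have "cycle_verts G p = insert (tail G (hd p)) (head G ` set p)"
    unfolding cycle_verts_awalk[OF u(1,3)] awalk_verts_conv'[OF cas] using u(3) by simp
  moreover have "head G (last p) \<in> head G ` set p" using u(3) by simp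
  ultimately show eq: "cycle_verts G p = head G ` set p" by (simp add: insert_absorb)
  show "card (cycle_verts G p) = length p"
    unfolding eq using u(2) unfolding tl by (metis distinct_card length_map list.set_map)
  show "distinct p" "set p \<subseteq> arcs G" using u by auto
qed

lemma sym_induce_subgraph: "sym_digraph (G \<restriction> S)"
proof -
  interpret H: wf_digraph "G \<restriction> S" ..
  show ?thesis
  proof
    show "symmetric (G \<restriction> S)"
      using sym_arcs by (fastforce simp: symmetric_conv)
  qed
qed

text \<open>The cycle is itself a closed walk in the induced subgraph: follow it from
  \<open>u\<close> to its base \<open>w\<close>, then from \<open>w\<close> to
  \<open>v\<close>.\<close>

lemma cycle_reachable_induce:
  assumes p: "cycle p" "cycle_verts G p \<subseteq> S"
    and uv: "u \<in> cycle_verts G p" "v \<in> cycle_verts G p"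
  shows "u \<rightarrow>\<^sup>*\<^bsub>G \<restriction> S\<^esub> v"
proof -
  interpret H: wf_digraph "G \<restriction> S" ..
  obtain w where w: "awalk w p w" "p \<noteq> []" using p(1) unfolding cycle_def by blast
  have verts: "set (awalk_verts w p) = cycle_verts G p"
    using cycle_verts_awalk[OF w] by simp
  have "tail G a \<in> S \<and> head G a \<in> S" if "a \<in> set p" for a
    using that p(2) cycle_verts_eq_heads(1)[OF p(1)] by (auto simp: cycle_verts_def)
  moreover have "w \<in> S" using w(1) verts p(2) hd_in_awalk_verts(1) by blast
  ultimately have "H.awalk w p w"
    using w(1) by (auto simp: H.awalk_def awalk_def compatible_cas[OF compatible_induce_subgraph])
  moreover have "H.awalk_verts w p = awalk_verts w p"
    by (simp add: compatible_awalk_verts[OF compatible_induce_subgraph])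
  ultimately have "u \<rightarrow>\<^sup>*\<^bsub>G \<restriction> S\<^esub> w" "w \<rightarrow>\<^sup>*\<^bsub>G \<restriction> S\<^esub> v"
    using H.awalk_verts_reachable_to H.awalk_verts_reachable_from uv verts by metis+
  thus ?thesis by (rule H.reachable_trans)
qed

lemma connected_cycle_union_iff:
  assumes p: "cycle p" and q: "cycle q" and disj: "cycle_verts G p \<inter> cycle_verts G q = {}"
  shows "graph_connected (G \<restriction> (cycle_verts G p \<union> cycle_verts G q)) \<longleftrightarrow>
    (\<exists>u\<in>cycle_verts G p. \<exists>v\<in>cycle_verts G q. {u, v} \<in> edges G)"
    (is "graph_connected ?H \<longleftrightarrow> ?joined")
proof -
  let ?U = "cycle_verts G p" and ?W = "cycle_verts G q"
  interpret H: sym_digraph ?H by (rule sym_induce_subgraph)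
  have ne: "?U \<noteq> {}" "?W \<noteq> {}"
    using p q by (auto simp: cycle_def cycle_verts_def)
  show ?thesis
  proof
    assume "graph_connected ?H"
    hence sc: "strongly_connected ?H"
      by (intro H.symmetric_connected_imp_strongly_connected H.sym_arcs)
    obtain u w where uw: "u \<in> ?U" "w \<in> ?W" using ne by blast
    hence "u \<rightarrow>\<^sup>*\<^bsub>?H\<^esub> w" using sc by (auto simp: strongly_connected_def)
    \<comment> \<open>Invariant of the walk: the first step that leaves \<open>?U\<close> enters
      \<open>?W\<close> and is a joining edge.\<close>
    hence "w \<in> ?U \<or> ?joined"
    proof (induction rule: H.reachable_induct)
      case (step v w)
      hence "(v, w) \<in> arcs_ends G" "w \<in> ?U \<union> ?W"
        by (auto simp: arcs_ends_conv)
      thus ?case using step.IH by (auto simp: edges_iff)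
    qed (use uw in simp)
    thus ?joined using uw disj by blast
  next
    assume ?joined
    then obtain u w where uw: "u \<in> ?U" "w \<in> ?W" "(u, w) \<in> arcs_ends G"
      by (auto simp: edges_iff)
    have "u \<rightarrow>\<^bsub>?H\<^esub> w" using uw by (auto simp: arcs_ends_conv image_iff)
    hence adj: "u \<rightarrow>\<^sup>*\<^bsub>?H\<^esub> w" by (rule H.reachable_adjI)
    \<comment> \<open>With \<open>u\<close> as a hub, vertices of the second cycle go through
      \<open>w\<close>; symmetry then connects any two vertices.\<close>
    have to_u: "v \<rightarrow>\<^sup>*\<^bsub>?H\<^esub> u" if "v \<in> ?U \<union> ?W" for v
    proof (cases "v \<in> ?U")
      case True
      thus ?thesis using cycle_reachable_induce[OF p] uw by blast
    next
      case False
      hence "v \<rightarrow>\<^sup>*\<^bsub>?H\<^esub> w" using that cycle_reachable_induce[OF q] uw by blast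
      thus ?thesis using symmetric_reachable[OF H.sym_arcs adj] by (rule H.reachable_trans)
    qed
    have "strongly_connected ?H"
    proof
      fix v v' assume "v \<in> verts ?H" "v' \<in> verts ?H"
      hence "v \<rightarrow>\<^sup>*\<^bsub>?H\<^esub> u" "v' \<rightarrow>\<^sup>*\<^bsub>?H\<^esub> u" using to_u by auto
      thus "v \<rightarrow>\<^sup>*\<^bsub>?H\<^esub> v'"
        using symmetric_reachable[OF H.sym_arcs] H.reachable_trans by blast
    qed (use ne in auto)
    thus "graph_connected ?H"
      unfolding Digraph_Component.connected_def strongly_connected_def
      using H.reachable_mk_symmetricI by simp
  qed
qed

end

section \<open>The integer rounding property\<close>

lemma feasible_incidence_matrix:
  "y \<in> feasible (incidence_matrix x e) a \<longleftrightarrow> covers (\<lambda>j. x -` e j) (($) a) y"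
proof -
  have "(map_matrix real (incidence_matrix x e) *v y) $ i = load (\<lambda>j. x -` e j) y i" for i
  proof -
    have "(map_matrix real (incidence_matrix x e) *v y) $ i
        = (\<Sum>j\<in>UNIV. if x i \<in> e j then y $ j else 0)"
      unfolding matrix_vector_mult_def
      by (auto simp: incidence_matrix_def map_matrix_def intro!: sum.cong)
    thus ?thesis by (simp add: load_def sum.If_cases)
  qed
  thus ?thesis by (simp add: feasible_def covers_def less_eq_vec_def)
qed

lemma inner_one: "y \<bullet> (1 :: real^'q) = (\<Sum>j\<in>UNIV. y $ j)"
  by (simp add: inner_vec_def)

text \<open>Every edge with nonzero value has both ends in \<open>C\<close> or none, so it
  contributes twice its value or nothing to the total load on \<open>C\<close>.\<close>

lemma integral_cover_parity:
  fixes f :: "'q::finite \<Rightarrow> 'n::finite set"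
  assumes card2: "\<And>j. card (f j) = 2"
    and y: "\<And>j. y $ j \<in> \<int>" "\<And>i. i \<in> C \<Longrightarrow> load f y i = 1"
    and supp: "\<And>j. y $ j \<noteq> 0 \<Longrightarrow> f j \<subseteq> C \<or> f j \<inter> C = {}"
  shows "even (card C)"
proof -
  have "real (card C) = (\<Sum>i\<in>C. load f y i)" using y(2) by simp
  also have "\<dots> = (\<Sum>j\<in>UNIV. real (card (f j \<inter> C)) * y $ j)" by (rule sum_load)
  also have "\<dots> = (\<Sum>j\<in>UNIV. if f j \<subseteq> C then 2 * y $ j else 0)"
  proof (intro sum.cong refl)
    fix j
    show "real (card (f j \<inter> C)) * y $ j = (if f j \<subseteq> C then 2 * y $ j else 0)"
      using supp[of j] card2[of j] by (cases "y $ j = 0") (auto simp: Int_absorb2)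
  qed
  also have "\<dots> = 2 * (\<Sum>j | f j \<subseteq> C. y $ j)"
    by (simp add: sum.If_cases sum_distrib_left)
  finally have card: "real (card C) = 2 * (\<Sum>j | f j \<subseteq> C. y $ j)" .
  have "(\<Sum>j | f j \<subseteq> C. y $ j) \<in> \<int>" using y(1) by (intro Ints_sum)
  then obtain N where "(\<Sum>j | f j \<subseteq> C. y $ j) = of_int N" by (rule Ints_cases)
  with card have "of_int (int (card C)) = (of_int (2 * N) :: real)" by simp
  hence "int (card C) = 2 * N" by (simp only: of_int_eq_iff)
  hence "even (int (card C))" by simp
  thus ?thesis by simp
qed

text \<open>For demand one on \<open>C \<union> C'\<close> the cover \<open>y + y'\<close> is
  optimal, with integral value \<open>h\<close>. An integral cover of total \<open>h\<close> has no
  surplus, so its edges lie inside \<open>C \<union> C'\<close> and, by \<open>sep\<close>, inside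
  \<open>C\<close> or \<open>C'\<close>; parity then fails.\<close>

lemma disjoint_odd_sets_not_rounding:
  fixes x :: "'n::finite \<Rightarrow> 'a" and e :: "'q::finite \<Rightarrow> 'a set"
  defines "f \<equiv> \<lambda>j. x -` e j"
  assumes card2: "\<And>j. card (f j) = 2"
    and odd: "odd (card C)" "odd (card C')" and disj: "C \<inter> C' = {}"
    and sep: "\<And>j. \<not> (f j \<inter> C \<noteq> {} \<and> f j \<inter> C' \<noteq> {})"
    and half: "covers f (\<lambda>i. if i \<in> C then 1 else 0) y" "(\<Sum>j\<in>UNIV. y $ j) = card C / 2"
    and half': "covers f (\<lambda>i. if i \<in> C' then 1 else 0) y'" "(\<Sum>j\<in>UNIV. y' $ j) = card C' / 2"
  shows "\<not> integer_rounding (incidence_matrix x e)"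
proof
  assume rounding: "integer_rounding (incidence_matrix x e)"
  define a :: "int^'n" where "a = (\<chi> i. if i \<in> C \<union> C' then 1 else 0)"
  have sum_a: "(\<Sum>i\<in>UNIV. real_of_int (a $ i)) = card C + card C'"
  proof -
    have "(\<Sum>i\<in>UNIV. real_of_int (a $ i)) = (\<Sum>i\<in>UNIV. if i \<in> C \<union> C' then 1 else 0)"
      by (intro sum.cong) (auto simp: a_def)
    also have "\<dots> = card (C \<union> C')" by (simp add: sum.If_cases Un_def)
    finally show ?thesis using disj by (simp add: card_Un_disjoint)
  qed
  have sum_load2: "(\<Sum>i\<in>UNIV. load f z i) = 2 * (\<Sum>j\<in>UNIV. z $ j)" for z
    by (simp add: sum_load card2 sum_distrib_left)
  obtain h where h: "card C + card C' = 2 * h" using odd by (metis odd_even_add dvdE)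
  have "is_min {z \<bullet> 1 |z. z \<in> feasible (incidence_matrix x e) a} (real h)"
    unfolding is_min_def
  proof (intro conjI ballI)
    have "covers f (($) a) (y + y')"
      unfolding covers_def load_add
    proof (intro conjI allI)
      fix j show "0 \<le> (y + y') $ j" using half(1) half'(1) by (simp add: covers_def)
    next
      fix i
      have "(if i \<in> C then 1 else 0) \<le> load f y i" "(if i \<in> C' then 1 else 0) \<le> load f y' i"
        using half(1) half'(1) unfolding covers_def by (auto dest: spec[of _ i])
      thus "of_int (a $ i) \<le> load f y i + load f y' i"
        using disj by (auto simp: a_def split: if_splits)
    qed
    moreover have "(\<Sum>j\<in>UNIV. (y + y') $ j) = real h"
      using half(2) half'(2) arg_cong[OF h, of real] by (simp add: sum.distrib)
    ultimately show "real h \<in> {z \<bullet> 1 |z. z \<in> feasible (incidence_matrix x e) a}"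
      unfolding feasible_incidence_matrix inner_one f_def
      by (intro CollectI exI[of _ "y + y'"]) simp
  next
    fix r assume "r \<in> {z \<bullet> 1 |z. z \<in> feasible (incidence_matrix x e) a}"
    then obtain z where z: "r = (\<Sum>j\<in>UNIV. z $ j)" "covers f (($) a) z"
      unfolding feasible_incidence_matrix inner_one f_def by blast
    hence "(\<Sum>i\<in>UNIV. real_of_int (a $ i)) \<le> (\<Sum>i\<in>UNIV. load f z i)"
      by (intro sum_mono) (auto simp: covers_def)
    thus "real h \<le> r" using sum_a sum_load2[of z] z(1) arg_cong[OF h, of real] by simp
  qed
  hence "is_min {z \<bullet> 1 |z. z \<in> feasible (incidence_matrix x e) a \<and> (\<forall>j. z $ j \<in> \<nat>)} (real h)"
    using rounding unfolding integer_rounding_def by fastforce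
  then obtain z where z: "covers f (($) a) z" "\<And>j. z $ j \<in> \<nat>" "(\<Sum>j\<in>UNIV. z $ j) = real h"
    unfolding is_min_def feasible_incidence_matrix inner_one f_def by auto
  \<comment> \<open>The nonnegative surpluses sum to zero, because the total load is twice the total
    value.\<close>
  have z_load: "load f z i = a $ i" for i
  proof -
    have "(\<Sum>i\<in>UNIV. load f z i - a $ i) = 0"
      using sum_a sum_load2[of z] z(3) arg_cong[OF h, of real] by (simp add: sum_subtractf)
    moreover have "0 \<le> load f z i - a $ i" for i using z(1) by (simp add: covers_def)
    ultimately have "load f z i - a $ i = 0"
      by (subst (asm) sum_nonneg_eq_0_iff) auto
    thus ?thesis by simp
  qed
  have supp: "f j \<subseteq> C \<union> C'" if "z $ j \<noteq> 0" for j
  proof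
    fix i assume i: "i \<in> f j"
    have "0 \<le> z $ k" for k using z(1) by (simp add: covers_def)
    hence "z $ j \<le> load f z i"
      unfolding load_def using i by (intro member_le_sum) auto
    with \<open>0 \<le> z $ j\<close> that have "0 < load f z i" by simp
    thus "i \<in> C \<union> C'" unfolding z_load by (auto simp: a_def split: if_splits)
  qed
  have "even (card C)"
  proof (rule integral_cover_parity[OF card2])
    show "z $ j \<in> \<int>" for j using z(2) Nats_subset_Ints by blast
    show "load f z i = 1" if "i \<in> C" for i using that by (simp add: z_load a_def)
    show "f j \<subseteq> C \<or> f j \<inter> C = {}" if "z $ j \<noteq> 0" for j
      using supp[OF that] sep[of j] by blast
  qed
  with odd(1) show False by simp
qed

lemma (in graph) cycle_half_cover:
  fixes x :: "'n::finite \<Rightarrow> 'a" and e :: "'q::finite \<Rightarrow> 'a set"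
  assumes x: "bij_betw x UNIV (verts G)" and e: "bij_betw e UNIV (edges G)" and p: "cycle p"
  obtains y where "covers (\<lambda>j. x -` e j) (\<lambda>i. if i \<in> x -` cycle_verts G p then 1 else 0) y"
    "(\<Sum>j\<in>UNIV. y $ j) = length p / 2"
proof -
  define E where "E b = inv e {tail G b, head G b}" for b
  have eE: "e (E b) = {tail G b, head G b}" if "b \<in> set p" for b
  proof -
    have "{tail G b, head G b} \<in> range e"
      using that cycle_verts_eq_heads(4)[OF p] e by (auto simp: bij_betw_def edges_def)
    thus ?thesis unfolding E_def by (rule f_inv_into_f)
  qed
  \<comment> \<open>Summed over arcs, so that for a cycle of length two both halves add up on its
    only edge.\<close>
  define y where "y = (\<Sum>b\<in>set p. axis (E b) (1 / 2 :: real))"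
  have load_y: "load (\<lambda>j. x -` e j) y i
      = (\<Sum>b\<in>set p. if x i \<in> {tail G b, head G b} then 1 / 2 else 0)" for i
    unfolding y_def load_simps by (intro sum.cong refl) (simp add: eE)
  show ?thesis
  proof (rule that)
    show "covers (\<lambda>j. x -` e j) (\<lambda>i. if i \<in> x -` cycle_verts G p then 1 else 0) y"
      unfolding covers_def
    proof (intro conjI allI)
      fix j show "0 \<le> y $ j"
        unfolding y_def sum_component by (intro sum_nonneg) (simp add: axis_def)
    next
      fix i
      show "of_int (if i \<in> x -` cycle_verts G p then 1 else 0) \<le> load (\<lambda>j. x -` e j) y i"
      proof (cases "x i \<in> cycle_verts G p")
        case True
        then obtain b where b: "b \<in> set p" "tail G b = x i" by (auto simp: cycle_verts_def)
        from True obtain c where c: "c \<in> set p" "head G c = x i"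
          using cycle_verts_eq_heads(1)[OF p] by auto
        \<comment> \<open>Each cycle vertex gets one half from the arc leaving it and one half from
          the arc entering it; they differ because there are no loops.\<close>
        have "b \<noteq> c" using b c no_loops cycle_verts_eq_heads(4)[OF p] by (metis subsetD)
        have "1 = (\<Sum>b\<in>{b, c}. if x i \<in> {tail G b, head G b} then 1 / 2 else (0::real))"
          using \<open>b \<noteq> c\<close> b c by simp
        also have "\<dots> \<le> load (\<lambda>j. x -` e j) y i"
          unfolding load_y using b c by (intro sum_mono2) auto
        finally show ?thesis using True by simp
      next
        case False
        thus ?thesis unfolding load_y by (simp add: sum_nonneg)
      qed
    qed
    have "(\<Sum>j\<in>UNIV. y $ j) = (\<Sum>b\<in>set p. \<Sum>j\<in>UNIV. axis (E b) (1 / 2 :: real) $ j)"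
      unfolding y_def sum_component by (rule sum.swap)
    also have "\<dots> = card (set p) / 2" by (simp add: sum_axis)
    finally show "(\<Sum>j\<in>UNIV. y $ j) = length p / 2"
      using cycle_verts_eq_heads(3)[OF p] by (simp add: distinct_card)
  qed
qed

theorem theorem1p3p2:
  fixes G :: "('a,'b) pre_digraph"
    and x :: "'n::finite \<Rightarrow> 'a" and e :: "'q::finite \<Rightarrow> 'a set"
  assumes "graph G" and "graph_connected G" and "edges G \<noteq> {}"
    and "bij_betw x UNIV (verts G)" and "bij_betw e UNIV (edges G)"
  shows "integer_rounding (incidence_matrix x e) \<longleftrightarrow>
    (\<forall>p q. odd_cycle G p \<and> odd_cycle G q \<and> cycle_verts G p \<inter> cycle_verts G q = {} \<longrightarrow>
       graph_connected (G \<restriction> (cycle_verts G p \<union> cycle_verts G q)))"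
    (is "?rounding \<longleftrightarrow> ?cycles")
proof -
  interpret graph G by fact
  note x = \<open>bij_betw x UNIV (verts G)\<close> and e = \<open>bij_betw e UNIV (edges G)\<close>
  have inj_x: "inj x" and range_x: "range x = verts G" using x by (auto simp: bij_betw_def)
  have inj_e: "inj e" and range_e: "range e = edges G" using e by (auto simp: bij_betw_def)
  \<comment> \<open>Edges pulled back along \<open>x\<close> to sets of row indices, the form in
    which the rounding lemmas are stated.\<close>
  define f where "f j = x -` e j" for j
  have e_edge: "e j \<in> edges G" for j using range_e by blast
  have x_f: "x ` f j = e j" for j
    using e_edge[of j] range_x by (auto simp: f_def edges_def)
  have card2: "card (f j) = 2" for j
  proof -
    have "card (e j) = 2" using e_edge[of j] by (auto elim: edgesE)
    thus ?thesis using x_f[of j] card_image[of x "f j"] inj_x by (simp add: inj_on_def inj_def)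
  qed
  have inj_f: "inj f" using x_f inj_e by (metis injI inj_eq)
  have range_f: "{i, i'} \<in> range f \<longleftrightarrow> {x i, x i'} \<in> edges G" for i i'
  proof
    assume "{i, i'} \<in> range f"
    then obtain j where "f j = {i, i'}" by force
    thus "{x i, x i'} \<in> edges G" using x_f[of j] e_edge[of j] by simp
  next
    assume "{x i, x i'} \<in> edges G"
    then obtain j where "e j = {x i, x i'}" unfolding range_e[symmetric] by force
    hence "f j = {i, i'}" using inj_x by (auto simp: f_def inj_def)
    thus "{i, i'} \<in> range f" by blast
  qed
  show ?thesis
  proof
    assume cycles: ?cycles
    have cycle_x: "cycle_in (edges G) (x \<circ> s) k" if "cycle_in (range f) s k" for s k
      using that inj_x range_f by (auto simp: cycle_in_def inj_on_def inj_def)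
    have joined: "\<exists>m n. {s m, t n} \<in> range f"
      if st: "cycle_in (range f) s k" "cycle_in (range f) t l" "odd k" "odd l" "range s \<inter> range t = {}"
      for s t k l
    proof -
      obtain p where p: "cycle p" "length p = k" "cycle_verts G p = range (x \<circ> s)"
        using cycle_in_imp_cycle[OF cycle_x[OF st(1)]] .
      obtain q where q: "cycle q" "length q = l" "cycle_verts G q = range (x \<circ> t)"
        using cycle_in_imp_cycle[OF cycle_x[OF st(2)]] .
      have disj: "cycle_verts G p \<inter> cycle_verts G q = {}"
        using st(5) inj_x unfolding p(3) q(3) by (auto simp: inj_def)
      moreover have "odd_cycle G p" "odd_cycle G q"
        using p q st(3,4) by (simp_all add: odd_cycle_def)
      ultimately have "graph_connected (G \<restriction> (cycle_verts G p \<union> cycle_verts G q))"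
        using cycles by blast
      then obtain u v where "u \<in> cycle_verts G p" "v \<in> cycle_verts G q" "{u, v} \<in> edges G"
        unfolding connected_cycle_union_iff[OF p(1) q(1) disj] by blast
      then obtain m n where "{x (s m), x (t n)} \<in> edges G" unfolding p(3) q(3) by auto
      thus ?thesis using range_f by blast
    qed
    show ?rounding
      unfolding integer_rounding_def feasible_incidence_matrix inner_one f_def[symmetric]
    proof (intro allI impI)
      fix a :: "int^'n" and m :: real
      assume "is_min {(\<Sum>j\<in>UNIV. y $ j) |y. covers f (($) a) y} m"
      then obtain y0 where y0: "covers f (($) a) y0" "(\<Sum>j\<in>UNIV. y0 $ j) = m"
        and m: "\<And>y. covers f (($) a) y \<Longrightarrow> m \<le> (\<Sum>j\<in>UNIV. y $ j)"
        unfolding is_min_def by blast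
      \<comment> \<open>An integral cover has an integral total of at least \<open>m\<close>, hence
        at least its ceiling.\<close>
      have lower: "of_int \<lceil>m\<rceil> \<le> (\<Sum>j\<in>UNIV. y $ j)"
        if "covers f (($) a) y" "\<And>j. y $ j \<in> \<int>" for y
      proof -
        have "(\<Sum>j\<in>UNIV. y $ j) \<in> \<int>" using that(2) by (intro Ints_sum)
        then obtain N where "(\<Sum>j\<in>UNIV. y $ j) = of_int N" by (rule Ints_cases)
        thus ?thesis using m[OF that(1)] by (simp add: ceiling_le)
      qed
      have sum_y0: "(\<Sum>j\<in>UNIV. y0 $ j) \<le> of_int \<lceil>m\<rceil>" using y0(2) by simp
      have "\<exists>y. covers f (($) a) y \<and> (\<forall>j. y $ j \<in> \<int>) \<and> (\<Sum>j\<in>UNIV. y $ j) \<le> of_int \<lceil>m\<rceil>"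
        by (rule integral_cover[of f "($) a" y0]) (fact inj_f card2 joined y0(1) sum_y0)+
      then obtain y where y: "covers f (($) a) y" "\<And>j. y $ j \<in> \<int>"
        "(\<Sum>j\<in>UNIV. y $ j) \<le> of_int \<lceil>m\<rceil>"
        by blast
      have "y $ j \<in> \<nat>" for j
        using y(1,2) by (auto simp: covers_def Nats_altdef2)
      moreover have "of_int \<lceil>m\<rceil> = (\<Sum>j\<in>UNIV. y $ j)" using lower[OF y(1,2)] y(3) by simp
      ultimately have attained: "of_int \<lceil>m\<rceil>
          \<in> {(\<Sum>j\<in>UNIV. y $ j) |y. covers f (($) a) y \<and> (\<forall>j. y $ j \<in> \<nat>)}"
        using y(1) by (intro CollectI exI[of _ y]) simp
      show "is_min {(\<Sum>j\<in>UNIV. y $ j) |y. covers f (($) a) y \<and> (\<forall>j. y $ j \<in> \<nat>)}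
          (of_int \<lceil>m\<rceil>)"
        unfolding is_min_def
      proof (intro conjI ballI attained)
        fix r assume "r \<in> {(\<Sum>j\<in>UNIV. y $ j) |y. covers f (($) a) y \<and> (\<forall>j. y $ j \<in> \<nat>)}"
        then obtain z where z: "r = (\<Sum>j\<in>UNIV. z $ j)" "covers f (($) a) z" "\<And>j. z $ j \<in> \<nat>"
          by blast
        show "of_int \<lceil>m\<rceil> \<le> r"
          unfolding z(1) using z(3) Nats_subset_Ints by (intro lower[OF z(2)]) blast
      qed
    qed
  next
    assume rounding: ?rounding
    show ?cycles
    proof (intro allI impI, elim conjE)
      fix p q assume "odd_cycle G p" "odd_cycle G q"
        and disj: "cycle_verts G p \<inter> cycle_verts G q = {}"
      hence p: "cycle p" "odd (length p)" and q: "cycle q" "odd (length q)"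
        by (auto simp: odd_cycle_def)
      show "graph_connected (G \<restriction> (cycle_verts G p \<union> cycle_verts G q))"
      proof (rule ccontr)
        assume not_joined: "\<not> ?thesis"
        define C where "C r = x -` cycle_verts G r" for r
        have card_C: "card (C r) = length r" if "cycle r" for r
        proof -
          have "cycle_verts G r \<subseteq> range x"
            using cycle_verts_eq_heads(4)[OF that] range_x by (auto simp: cycle_verts_def)
          hence "x ` C r = cycle_verts G r" by (auto simp: C_def)
          thus ?thesis using card_image[of x "C r"] inj_x cycle_verts_eq_heads(2)[OF that]
            by (simp add: inj_on_def inj_def)
        qed
        obtain y where y: "covers f (\<lambda>i. if i \<in> C p then 1 else 0) y"
          "(\<Sum>j\<in>UNIV. y $ j) = length p / 2"
          using cycle_half_cover[OF x e p(1)] unfolding f_def[symmetric] C_def[symmetric] .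
        obtain y' where y': "covers f (\<lambda>i. if i \<in> C q then 1 else 0) y'"
          "(\<Sum>j\<in>UNIV. y' $ j) = length q / 2"
          using cycle_half_cover[OF x e q(1)] unfolding f_def[symmetric] C_def[symmetric] .
        \<comment> \<open>An edge of \<open>G\<close> meeting both sets would join the cycles, which
          \<open>connected_cycle_union_iff\<close> turns into connectedness.\<close>
        have sep: "\<not> (f j \<inter> C p \<noteq> {} \<and> f j \<inter> C q \<noteq> {})" for j
        proof
          assume "f j \<inter> C p \<noteq> {} \<and> f j \<inter> C q \<noteq> {}"
          then obtain i i' where i: "i \<in> f j" "i \<in> C p" "i' \<in> f j" "i' \<in> C q" by blast
          moreover have "i \<noteq> i'" using i disj by (auto simp: C_def)
          ultimately have "f j = {i, i'}" using card2[of j] by (auto simp: card_2_iff)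
          hence "{x i, x i'} \<in> edges G" using range_f[of i i'] by (metis rangeI)
          thus False
            using not_joined i unfolding connected_cycle_union_iff[OF p(1) q(1) disj]
            by (auto simp: C_def)
        qed
        have "\<not> ?rounding"
        proof (rule disjoint_odd_sets_not_rounding[of x e "C p" "C q", folded f_def])
          show "C p \<inter> C q = {}" using disj by (auto simp: C_def)
        qed (use card2 sep p q y y' in \<open>simp_all add: card_C\<close>)
        with rounding show False by simp
      qed
    qed
  qed
qed

end
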